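(* The generalized Narayana polynomials of the exceptional simple Lie algebras are $$\mathcal N_{G_2}(q)=1+6q+q^2,$$ $$\mathcal N_{F_4}(q)=1+24q+55q^2+24q^3+q^4,$$ $$\mathcal N_{E_6}(q)=1+36q+204q^2+351q^3+204q^4+36q^5+q^6,$$ $$\mathcal N_{E_7}(q)=1+63q+546q^2+1470q^3+1470q^4+546q^5+63q^6+q^7,$$ $$\mathcal N_{E_8}(q)=1+120q+1540q^2+6120q^3+9518q^4+6120q^5+1540q^6+120q^7+q^8;$$ in particular, they are palindromic.
   Context: For a simple Lie algebra $\mathfrak g$ of rank $p$ with positive roots $\Delta^+$, partially ordered by $\mu\preccurlyeq\nu$ iff $\nu-\mu$ is a nonnegative integer combination of simple roots, let $d_k(\mathfrak g)$ be the number of $k$-element antichains in $(\Delta^+,\preccurlyeq)$ (equivalently, the number of $\mathsf{ad}$-nilpotent ideals of a Borel subalgebra with exactly $k$ generators). The generalized Narayana polynomial is $\mathcal N_{\mathfrak g}(q)=\sum_{k=0}^pd_k(\mathfrak g)q^k$; palindromic means $d_k(\mathfrak g)=d_{p-k}(\mathfrak g)$ for all $k$. *)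

theory Defs
  imports
    "HOL-Library.Function_Algebras"
    "HOL-Computational_Algebra.Polynomial"
begin

locale lie_algebra = vector_space scale
  for scale :: "'k::field \<Rightarrow> 'g::ab_group_add \<Rightarrow> 'g" (infixr \<open>*s\<close> 75) +
  fixes bracket :: "'g \<Rightarrow> 'g \<Rightarrow> 'g"
  assumes linear_bracket_left: "Vector_Spaces.linear scale scale (\<lambda>x. bracket x y)"
    and linear_bracket_right: "Vector_Spaces.linear scale scale (\<lambda>y. bracket x y)"
    and bracket_self: "bracket x x = 0"
    and jacobi: "bracket x (bracket y z) + bracket y (bracket z x) + bracket z (bracket x y) = 0"
begin

definition lie_ideal :: "'g set \<Rightarrow> bool" where
  "lie_ideal I \<longleftrightarrow> subspace I \<and> (\<forall>x. \<forall>y\<in>I. bracket x y \<in> I)"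

definition abelian_subalgebra :: "'g set \<Rightarrow> bool" where
  "abelian_subalgebra K \<longleftrightarrow> subspace K \<and> (\<forall>x\<in>K. \<forall>y\<in>K. bracket x y = 0)"

text \<open>Over an algebraically closed field, \<open>ad x\<close> is a semisimple endomorphism of a
  finite-dimensional algebra iff it is diagonalizable.\<close>

definition ad_semisimple :: "'g \<Rightarrow> bool" where
  "ad_semisimple x \<longleftrightarrow> span {y. \<exists>c. bracket x y = c *s y} = UNIV"

text \<open>The textbook definition for semisimple Lie algebras: a maximal abelian subalgebra all of
  whose elements are ad-semisimple.\<close>

definition cartan_subalgebra :: "'g set \<Rightarrow> bool" where
  "cartan_subalgebra H \<longleftrightarrow>
     abelian_subalgebra H \<and>
     (\<forall>K. abelian_subalgebra K \<longrightarrow> H \<subseteq> K \<longrightarrow> K = H) \<and>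
     (\<forall>x\<in>H. ad_semisimple x)"

text \<open>Linear forms on \<open>H\<close> are represented by functions that vanish outside \<open>H\<close>, so that equality
  of forms is equality of functions.\<close>

definition dual :: "'g set \<Rightarrow> ('g \<Rightarrow> 'k) set" where
  "dual H = {\<alpha>. (\<forall>x. x \<notin> H \<longrightarrow> \<alpha> x = 0) \<and>
                 (\<forall>x\<in>H. \<forall>y\<in>H. \<alpha> (x + y) = \<alpha> x + \<alpha> y) \<and>
                 (\<forall>c. \<forall>x\<in>H. \<alpha> (c *s x) = c * \<alpha> x)}"

definition form_scale :: "'k \<Rightarrow> ('g \<Rightarrow> 'k) \<Rightarrow> 'g \<Rightarrow> 'k" where
  "form_scale c \<alpha> = (\<lambda>x. c * \<alpha> x)"

definition weight_space :: "'g set \<Rightarrow> ('g \<Rightarrow> 'k) \<Rightarrow> 'g set" where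
  "weight_space H \<alpha> = {x. \<forall>h\<in>H. bracket h x = \<alpha> h *s x}"

definition roots :: "'g set \<Rightarrow> ('g \<Rightarrow> 'k) set" where
  "roots H = {\<alpha> \<in> dual H. \<alpha> \<noteq> 0 \<and> weight_space H \<alpha> \<noteq> {0}}"

definition nonneg_comb :: "('g \<Rightarrow> 'k) set \<Rightarrow> ('g \<Rightarrow> 'k) \<Rightarrow> bool" where
  "nonneg_comb \<Pi> \<mu> \<longleftrightarrow> (\<exists>n :: ('g \<Rightarrow> 'k) \<Rightarrow> nat. \<mu> = (\<Sum>\<alpha>\<in>\<Pi>. form_scale (of_nat (n \<alpha>)) \<alpha>))"

text \<open>\<open>\<Pi>\<close> is a base (a set of simple roots) of the root system of \<open>H\<close>.\<close>

definition simple_roots :: "'g set \<Rightarrow> ('g \<Rightarrow> 'k) set \<Rightarrow> bool" where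
  "simple_roots H \<Pi> \<longleftrightarrow>
     finite \<Pi> \<and> \<Pi> \<subseteq> roots H \<and> \<not> module.dependent form_scale \<Pi> \<and>
     (\<forall>\<beta>\<in>roots H. nonneg_comb \<Pi> \<beta> \<or> nonneg_comb \<Pi> (- \<beta>))"

definition positive_roots :: "'g set \<Rightarrow> ('g \<Rightarrow> 'k) set \<Rightarrow> ('g \<Rightarrow> 'k) set" where
  "positive_roots H \<Pi> = {\<beta> \<in> roots H. nonneg_comb \<Pi> \<beta>}"

definition root_le :: "('g \<Rightarrow> 'k) set \<Rightarrow> ('g \<Rightarrow> 'k) \<Rightarrow> ('g \<Rightarrow> 'k) \<Rightarrow> bool" where
  "root_le \<Pi> \<mu> \<nu> \<longleftrightarrow> nonneg_comb \<Pi> (\<nu> - \<mu>)"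

definition antichains :: "'g set \<Rightarrow> ('g \<Rightarrow> 'k) set \<Rightarrow> ('g \<Rightarrow> 'k) set set" where
  "antichains H \<Pi> = {A. finite A \<and> A \<subseteq> positive_roots H \<Pi> \<and>
                        (\<forall>\<mu>\<in>A. \<forall>\<nu>\<in>A. root_le \<Pi> \<mu> \<nu> \<longrightarrow> \<mu> = \<nu>)}"

definition num_antichains :: "'g set \<Rightarrow> ('g \<Rightarrow> 'k) set \<Rightarrow> nat \<Rightarrow> nat" where
  "num_antichains H \<Pi> k = card {A \<in> antichains H \<Pi>. card A = k}"

text \<open>The rank of the Lie algebra is the dimension of \<open>H\<close>.\<close>

definition narayana_poly :: "'g set \<Rightarrow> ('g \<Rightarrow> 'k) set \<Rightarrow> int poly" where
  "narayana_poly H \<Pi> = (\<Sum>k\<le>dim H. monom (int (num_antichains H \<Pi> k)) k)"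

definition narayana_palindromic :: "'g set \<Rightarrow> ('g \<Rightarrow> 'k) set \<Rightarrow> bool" where
  "narayana_palindromic H \<Pi> \<longleftrightarrow>
     (\<forall>k\<le>dim H. num_antichains H \<Pi> k = num_antichains H \<Pi> (dim H - k))"

text \<open>The coroot of \<open>\<alpha>\<close> is the unique \<open>h\<close> in \<open>[g\<^sub>\<alpha>, g\<^sub>-\<^sub>\<alpha>]\<close> with \<open>\<alpha>(h) = 2\<close>; in a simple Lie algebra
  this space is one-dimensional, so each of its elements is a single bracket.\<close>

definition is_coroot :: "'g set \<Rightarrow> ('g \<Rightarrow> 'k) \<Rightarrow> 'g \<Rightarrow> bool" where
  "is_coroot H \<alpha> h \<longleftrightarrow>
     (\<exists>e\<in>weight_space H \<alpha>. \<exists>f\<in>weight_space H (- \<alpha>). h = bracket e f) \<and> \<alpha> h = 2"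

text \<open>The entry in row \<open>i\<close> and column \<open>j\<close> of the Cartan matrix is the value of the \<open>i\<close>-th simple
  root on the \<open>j\<close>-th simple coroot.\<close>

definition has_cartan_matrix :: "'g set \<Rightarrow> ('g \<Rightarrow> 'k) set \<Rightarrow> int list list \<Rightarrow> bool" where
  "has_cartan_matrix H \<Pi> C \<longleftrightarrow>
     (\<exists>as. distinct as \<and> set as = \<Pi> \<and> length as = length C \<and>
        (\<forall>j<length C. \<exists>h. is_coroot H (as ! j) h \<and>
           (\<forall>i<length C. (as ! i) h = of_int (C ! i ! j))))"

end

locale simple_lie_algebra = lie_algebra scale bracket
  for scale :: "'k::{alg_closed_field, field_char_0} \<Rightarrow> 'g::ab_group_add \<Rightarrow> 'g"
  and bracket :: "'g \<Rightarrow> 'g \<Rightarrow> 'g" +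
  assumes finite_dimensional: "\<exists>B. finite B \<and> span B = UNIV"
    and nonabelian: "\<exists>x y. bracket x y \<noteq> 0"
    and ideal_trivial: "lie_ideal I \<Longrightarrow> I = {0} \<or> I = UNIV"

datatype exceptional_type = G2 | F4 | E6 | E7 | E8

text \<open>Cartan matrices in the numbering of Bourbaki.\<close>

fun cartan_matrix :: "exceptional_type \<Rightarrow> int list list" where
  "cartan_matrix G2 =
    [[ 2, -1],
     [-3,  2]]"
| "cartan_matrix F4 =
    [[ 2, -1,  0,  0],
     [-1,  2, -2,  0],
     [ 0, -1,  2, -1],
     [ 0,  0, -1,  2]]"
| "cartan_matrix E6 =
    [[ 2,  0, -1,  0,  0,  0],
     [ 0,  2,  0, -1,  0,  0],
     [-1,  0,  2, -1,  0,  0],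
     [ 0, -1, -1,  2, -1,  0],
     [ 0,  0,  0, -1,  2, -1],
     [ 0,  0,  0,  0, -1,  2]]"
| "cartan_matrix E7 =
    [[ 2,  0, -1,  0,  0,  0,  0],
     [ 0,  2,  0, -1,  0,  0,  0],
     [-1,  0,  2, -1,  0,  0,  0],
     [ 0, -1, -1,  2, -1,  0,  0],
     [ 0,  0,  0, -1,  2, -1,  0],
     [ 0,  0,  0,  0, -1,  2, -1],
     [ 0,  0,  0,  0,  0, -1,  2]]"
| "cartan_matrix E8 =
    [[ 2,  0, -1,  0,  0,  0,  0,  0],
     [ 0,  2,  0, -1,  0,  0,  0,  0],
     [-1,  0,  2, -1,  0,  0,  0,  0],
     [ 0, -1, -1,  2, -1,  0,  0,  0],
     [ 0,  0,  0, -1,  2, -1,  0,  0],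
     [ 0,  0,  0,  0, -1,  2, -1,  0],
     [ 0,  0,  0,  0,  0, -1,  2, -1],
     [ 0,  0,  0,  0,  0,  0, -1,  2]]"

end

(*
  The maximality of H makes H its own centralizer, so the coroots h_j lie in H and give sl_2-triples.
  sl_2-theory then shows that the simple reflections permute the roots and that no proper multiple
  of a simple root is a root.  Hence the coordinate vectors of the positive roots contain the unit
  vectors and are closed under each reflection s_j away from the j-th unit vector.  Since the inverse
  of the Cartan matrix is positive, every nonzero nonnegative vector is lowered in height by some
  s_j, and descent on the height shows that only one set of nonnegative nonzero vectors has these
  closure properties: the classical list.  The same inverse, together with the fact that the roots
  separate the points of H (an element of H killed by all roots is central), identifies the rank with
  the size of the matrix.  The antichains of the resulting explicit posets are counted by deciding,
  one root at a time, whether it belongs to the antichain.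
*)

theory Submission
  imports Defs
begin

section \<open>Counting antichains\<close>

text \<open>Generating polynomial of the antichains by size, with \<open>pCons 0\<close> as
  multiplication by q. Choosing the head deletes only what lies above it, so the count is right for
  lists in which no element lies above a later one.\<close>

fun antichain_poly :: "('a \<Rightarrow> 'a \<Rightarrow> bool) \<Rightarrow> 'a list \<Rightarrow> int poly" where
  "antichain_poly r [] = 1"
| "antichain_poly r (x # xs) =
     antichain_poly r xs + pCons 0 (antichain_poly r (filter (\<lambda>y. \<not> r x y) xs))"

definition antichains_in :: "('a \<Rightarrow> 'a \<Rightarrow> bool) \<Rightarrow> 'a set \<Rightarrow> nat \<Rightarrow> 'a set set" where
  "antichains_in r S k = {A. A \<subseteq> S \<and> (\<forall>x\<in>A. \<forall>y\<in>A. r x y \<longrightarrow> x = y) \<and> card A = k}"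

lemma finite_antichains_in: "finite S \<Longrightarrow> finite (antichains_in r S k)"
  by (rule finite_subset[of _ "Pow S"]) (auto simp: antichains_in_def)

lemma antichains_in_0: "finite S \<Longrightarrow> antichains_in r S 0 = {{}}"
  by (auto simp: antichains_in_def dest: finite_subset)

text \<open>Split on whether \<open>x\<close> belongs to the antichain. Since no element of
  \<open>S\<close> lies below \<open>x\<close>, choosing \<open>x\<close> only excludes the elements
  above it.\<close>

lemma antichains_in_insert:
  assumes "finite S" and "x \<notin> S" and "\<forall>y\<in>S. \<not> r y x"
  shows "antichains_in r (insert x S) (Suc k) =
    antichains_in r S (Suc k) \<union> insert x ` antichains_in r {y \<in> S. \<not> r x y} k"
    (is "?L = ?R")
proof
  show "?R \<subseteq> ?L"
  proof
    fix A assume "A \<in> ?R"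
    then consider "A \<in> antichains_in r S (Suc k)"
      | B where "A = insert x B" "B \<in> antichains_in r {y \<in> S. \<not> r x y} k" by auto
    then show "A \<in> ?L"
    proof cases
      case 2
      have "finite B" "x \<notin> B" using 2 assms by (auto simp: antichains_in_def dest: finite_subset)
      then show ?thesis using 2 assms by (fastforce simp: antichains_in_def)
    qed (auto simp: antichains_in_def)
  qed
  show "?L \<subseteq> ?R"
  proof
    fix A assume A: "A \<in> ?L"
    then have fin: "finite A" using assms by (auto simp: antichains_in_def dest: finite_subset)
    show "A \<in> ?R"
    proof (cases "x \<in> A")
      case True
      then have "A - {x} \<in> antichains_in r {y \<in> S. \<not> r x y} k" "A = insert x (A - {x})"
        using A fin by (auto simp: antichains_in_def)
      then show ?thesis by blast
    next
      case False
      then show ?thesis using A by (auto simp: antichains_in_def)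
    qed
  qed
qed

lemma card_antichains_in_insert:
  assumes "finite S" and "x \<notin> S" and "\<forall>y\<in>S. \<not> r y x"
  shows "card (antichains_in r (insert x S) (Suc k)) =
    card (antichains_in r S (Suc k)) + card (antichains_in r {y \<in> S. \<not> r x y} k)"
proof -
  have "inj_on (insert x) (antichains_in r {y \<in> S. \<not> r x y} k)"
    using assms(2) by (intro inj_onI) (auto simp: antichains_in_def insert_ident)
  moreover have "antichains_in r S (Suc k) \<inter> insert x ` antichains_in r {y \<in> S. \<not> r x y} k = {}"
    using assms(2) by (auto simp: antichains_in_def)
  ultimately show ?thesis
    using assms by (simp add: antichains_in_insert card_Un_disjoint finite_antichains_in card_image)
qed

text \<open>Sortedness makes the head new and minimal with respect to the tail, as
  \<open>card_antichains_in_insert\<close> requires, and it survives the filtering.\<close>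

lemma coeff_antichain_poly:
  assumes "sorted_wrt (\<lambda>x y. x \<noteq> y \<and> \<not> r y x) xs"
  shows "coeff (antichain_poly r xs) k = int (card (antichains_in r (set xs) k))"
  using assms
proof (induction r xs arbitrary: k rule: antichain_poly.induct)
  case (1 r)
  show ?case
  proof (cases k)
    case (Suc m)
    then have "antichains_in r {} k = {}" by (auto simp: antichains_in_def)
    then show ?thesis using Suc by simp
  qed (simp add: antichains_in_0)
next
  case (2 r x xs)
  have IH1: "coeff (antichain_poly r xs) k = int (card (antichains_in r (set xs) k))" for k
    using 2 by simp
  have IH2: "coeff (antichain_poly r (filter (\<lambda>y. \<not> r x y) xs)) k =
      int (card (antichains_in r {y \<in> set xs. \<not> r x y} k))" for k
    using 2(2)[of k] 2(3) sorted_wrt_filter by (auto simp: Collect_conj_eq)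
  show ?case
  proof (cases k)
    case 0
    then show ?thesis using IH1[of 0] by (simp add: antichains_in_0)
  next
    case (Suc m)
    have "x \<notin> set xs" "\<forall>y\<in>set xs. \<not> r y x" using 2(3) by auto
    then show ?thesis
      using card_antichains_in_insert[of "set xs" x r m] IH1[of k] IH2[of m] Suc by simp
  qed
qed

section \<open>Sets of vectors closed under reflections\<close>

text \<open>The conditionals in place of conjunctions and disjunctions, here and in \<open>reflection_in\<close>, make
  the simplifier evaluate lazily.\<close>

fun vec_le :: "int list \<Rightarrow> int list \<Rightarrow> bool" where
  "vec_le (x # xs) (y # ys) \<longleftrightarrow> (if x \<le> y then vec_le xs ys else False)"
| "vec_le xs ys \<longleftrightarrow> xs = [] \<and> ys = []"

lemma vec_le_eq_list_all2: "vec_le v w \<longleftrightarrow> list_all2 (\<le>) v w"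
  by (induction v w rule: vec_le.induct) auto

definition simple_vec :: "nat \<Rightarrow> nat \<Rightarrow> int list" where
  "simple_vec n j = (replicate n 0)[j := 1]"

text \<open>The value at the j-th coroot of the linear form with coordinates \<open>v\<close>,
  because \<open>C ! i ! j\<close> is the value of the i-th simple root there.\<close>

definition coroot_pairing :: "int list list \<Rightarrow> nat \<Rightarrow> int list \<Rightarrow> int" where
  "coroot_pairing C j v = (\<Sum>i\<leftarrow>[0..<length C]. v ! i * C ! i ! j)"

text \<open>The simple reflection s_j in coordinates: subtracting a multiple of the j-th simple root
  alters only coordinate \<open>j\<close>.\<close>

definition reflect :: "int list list \<Rightarrow> nat \<Rightarrow> int list \<Rightarrow> int list" where
  "reflect C j v = v[j := v ! j - coroot_pairing C j v]"

text \<open>The exception in the last clause reflects that s_j sends the j-th simple root to its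
  negative while permuting the other positive roots.\<close>

definition root_closed :: "int list list \<Rightarrow> int list set \<Rightarrow> bool" where
  "root_closed C R \<longleftrightarrow>
     (\<forall>v\<in>R. length v = length C \<and> (\<forall>x\<in>set v. 0 \<le> x) \<and> v \<noteq> replicate (length C) 0) \<and>
     (\<forall>j<length C. simple_vec (length C) j \<in> R) \<and>
     (\<forall>v\<in>R. \<forall>j<length C. v \<noteq> simple_vec (length C) j \<longrightarrow> reflect C j v \<in> R)"

text \<open>\<open>D = d C\<^sup>-\<^sup>1\<close> is kept integral by the factor \<open>d\<close>.\<close>

definition positive_inverse :: "int list list \<Rightarrow> int list list \<Rightarrow> int \<Rightarrow> bool" where
  "positive_inverse C D d \<longleftrightarrow> 0 < d \<and>
     (\<forall>i<length C. \<forall>j<length C. 0 < D ! i ! j \<and>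
        (\<Sum>k\<leftarrow>[0..<length C]. C ! i ! k * D ! k ! j) = (if i = j then d else 0))"

lemma length_reflect [simp]: "length (reflect C j v) = length v"
  by (simp add: reflect_def)

lemma coroot_pairing_eq_sum: "coroot_pairing C j v = (\<Sum>i<length C. v ! i * C ! i ! j)"
  unfolding coroot_pairing_def by (simp add: interv_sum_list_conv_sum_set_nat atLeast0LessThan)

lemma nth_simple_vec: "i < n \<Longrightarrow> simple_vec n j ! i = (if i = j then 1 else 0)"
  by (simp add: simple_vec_def nth_list_update)

lemma length_simple_vec [simp]: "length (simple_vec n j) = n"
  by (simp add: simple_vec_def)

lemma reflect_nth:
  "j < length v \<Longrightarrow> reflect C j v ! i = (if i = j then v ! j - coroot_pairing C j v else v ! i)"
  by (simp add: reflect_def nth_list_update)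

lemma coroot_pairing_reflect:
  assumes "j < length C" and "length v = length C" and "C ! j ! j = 2"
  shows "coroot_pairing C j (reflect C j v) = - coroot_pairing C j v"
proof -
  have "coroot_pairing C j (reflect C j v) =
      (\<Sum>i<length C. v ! i * C ! i ! j - (if i = j then coroot_pairing C j v * C ! i ! j else 0))"
    unfolding coroot_pairing_eq_sum[of C j "reflect C j v"] using assms
    by (intro sum.cong) (auto simp: reflect_nth algebra_simps)
  also have "\<dots> = coroot_pairing C j v - coroot_pairing C j v * 2"
    using assms by (simp add: sum_subtractf coroot_pairing_eq_sum)
  finally show ?thesis by simp
qed

lemma reflect_reflect:
  assumes "j < length C" and "length v = length C" and "C ! j ! j = 2"
  shows "reflect C j (reflect C j v) = v"
  using assms
  by (intro nth_equalityI) (auto simp: reflect_nth coroot_pairing_reflect)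

text \<open>Let p = vC be the vector of pairings. If p had no positive entry, neither would pD = d
  v, because \<open>D\<close> is positive; but d > 0 and \<open>v\<close> has a positive
  coordinate.\<close>

lemma exists_positive_pairing:
  assumes "positive_inverse C D d" and "length v = length C"
    and "\<forall>x\<in>set v. 0 \<le> x" and "v \<noteq> replicate (length C) 0"
  shows "\<exists>j<length C. 0 < coroot_pairing C j v"
proof (rule ccontr)
  let ?n = "length C"
  assume "\<not> ?thesis"
  then have nonpos: "coroot_pairing C j v \<le> 0" if "j < ?n" for j using that by force
  obtain m where m: "m < ?n" "v ! m \<noteq> 0"
    using assms(2,4) by (metis length_replicate nth_equalityI nth_replicate)
  have CD: "(\<Sum>k<?n. C ! i ! k * D ! k ! m) = (if i = m then d else 0)" if "i < ?n" for i
    using assms(1) that m(1)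
    by (simp add: positive_inverse_def interv_sum_list_conv_sum_set_nat atLeast0LessThan)
  have "(\<Sum>j<?n. coroot_pairing C j v * D ! j ! m) =
      (\<Sum>j<?n. \<Sum>i<?n. v ! i * (C ! i ! j * D ! j ! m))"
    by (simp add: coroot_pairing_eq_sum sum_distrib_right mult.assoc)
  also have "\<dots> = (\<Sum>i<?n. v ! i * (\<Sum>j<?n. C ! i ! j * D ! j ! m))"
    by (subst sum.swap) (simp add: sum_distrib_left)
  also have "\<dots> = (\<Sum>i<?n. if i = m then v ! i * d else 0)"
    by (intro sum.cong) (auto simp: CD)
  also have "\<dots> = v ! m * d" using m by simp
  also have "\<dots> > 0"
    using m assms by (metis positive_inverse_def mult_pos_pos nth_mem order_le_less)
  finally have "0 < (\<Sum>j<?n. coroot_pairing C j v * D ! j ! m)" .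
  moreover have "(\<Sum>j<?n. coroot_pairing C j v * D ! j ! m) \<le> 0"
    using nonpos m(1) assms(1)
    by (intro sum_nonpos mult_nonpos_nonneg) (auto simp: positive_inverse_def less_imp_le)
  ultimately show False by simp
qed

text \<open>Descent on the height \<open>sum_list v\<close>: choose \<open>j\<close> with positive
  pairing. Unless \<open>v\<close> is the j-th unit vector, s_j lowers the height within
  \<open>R\<close>, so induction puts s_j v into \<open>P\<close>, and closure of \<open>P\<close>
  under s_j brings \<open>v\<close> back.\<close>

lemma root_closed_subset:
  assumes D: "positive_inverse C D d" and diag: "\<forall>j<length C. C ! j ! j = 2"
    and R: "root_closed C R" and P: "root_closed C P"
  shows "R \<subseteq> P"
proof
  fix v assume "v \<in> R"
  then show "v \<in> P"
  proof (induction "nat (sum_list v)" arbitrary: v rule: less_induct)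
    case (less v)
    note v = less.prems
    have len: "length v = length C" and nonneg: "\<forall>x\<in>set v. 0 \<le> x"
      and nz: "v \<noteq> replicate (length C) 0"
      using R v by (auto simp: root_closed_def)
    obtain j where j: "j < length C" and pos: "0 < coroot_pairing C j v"
      using exists_positive_pairing[OF D len nonneg nz] by blast
    let ?w = "reflect C j v"
    show ?case
    proof (cases "v = simple_vec (length C) j")
      case True
      then show ?thesis using P j by (auto simp: root_closed_def)
    next
      case False
      then have w: "?w \<in> R" using R v j by (auto simp: root_closed_def)
      then have wnn: "\<forall>x\<in>set ?w. 0 \<le> x" using R by (auto simp: root_closed_def)
      have "sum_list ?w = (\<Sum>i<length C. v ! i - (if i = j then coroot_pairing C j v else 0))"
        unfolding sum_list_sum_nth using j len
        by (intro sum.cong) (auto simp: reflect_nth)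
      also have "\<dots> = sum_list v - coroot_pairing C j v"
        using j len by (simp add: sum_subtractf sum_list_sum_nth atLeast0LessThan)
      finally have "sum_list ?w = sum_list v - coroot_pairing C j v" .
      moreover have "0 \<le> sum_list ?w" using wnn by (simp add: sum_list_nonneg)
      ultimately have "?w \<in> P" using less.hyps w pos by simp
      moreover have inv: "reflect C j ?w = v" using reflect_reflect j len diag by simp
      \<comment> \<open>Closure of \<open>P\<close> applies to \<open>?w\<close> only away from the
        unit vector. As s_j negates that vector, equality would give \<open>v\<close> a coordinate
        -1.\<close>
      moreover have "?w \<noteq> simple_vec (length C) j"
      proof
        assume eq: "?w = simple_vec (length C) j"
        have "coroot_pairing C j ?w = (\<Sum>i<length C. if i = j then 2 else 0)"
          unfolding coroot_pairing_eq_sum eq using diag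
          by (intro sum.cong) (auto simp: nth_simple_vec)
        then have "v ! j = -1"
          using j len eq by (subst inv[symmetric]) (simp add: reflect_nth nth_simple_vec)
        then show False using nonneg j len by (metis neg_0_le_iff_le not_one_le_zero nth_mem)
      qed
      ultimately show ?thesis using P j by (metis root_closed_def)
    qed
  qed
qed

text \<open>\<open>reflection_in\<close> and \<open>root_closed_at\<close> are constants of their own so that the simplifier does not
  unfold them under the bound variables of \<open>list_all\<close>.\<close>

definition reflection_in :: "int list list \<Rightarrow> int list list \<Rightarrow> int list \<Rightarrow> nat \<Rightarrow> bool" where
  "reflection_in C P v j \<longleftrightarrow>
     (if v = simple_vec (length C) j then True
      else if coroot_pairing C j v = 0 then True
      else reflect C j v \<in> set P)"

definition root_closed_at :: "int list list \<Rightarrow> int list list \<Rightarrow> int list \<Rightarrow> bool" where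
  "root_closed_at C P v \<longleftrightarrow>
     length v = length C \<and> list_all ((\<le>) 0) v \<and> v \<noteq> replicate (length C) 0 \<and>
     list_all (reflection_in C P v) [0..<length C]"

text \<open>Turns closure into finite list checks that can be evaluated. Skipping reflections with
  pairing zero is sound: they fix \<open>v\<close>, which already lies in
  \<open>set P\<close>.\<close>

lemma root_closed_set_iff:
  "root_closed C (set P) \<longleftrightarrow>
     list_all (root_closed_at C P) P \<and>
     list_all (\<lambda>v. v \<in> set P) (map (simple_vec (length C)) [0..<length C])"
proof -
  have *: "(\<forall>j\<in>set [0..<length C]. Q j) \<longleftrightarrow> (\<forall>j<length C. Q j)" for Q by auto
  have "reflection_in C P v j \<longleftrightarrow> v = simple_vec (length C) j \<or> reflect C j v \<in> set P"
    if "v \<in> set P" for v j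
    using that by (auto simp: reflection_in_def reflect_def)
  then show ?thesis
    unfolding root_closed_def root_closed_at_def list_all_iff set_map
    by (simp add: * del: set_upt) blast
qed

section \<open>Brackets, eigenvectors and sl2-triples\<close>

lemma sum_fun_apply: "(\<Sum>i\<in>I. f i) x = (\<Sum>i\<in>I. f i x)"
  by (induction I rule: infinite_finite_induct) auto

context lie_algebra
begin

lemma bracket_add_left: "bracket (x + y) z = bracket x z + bracket y z"
  using linear_bracket_left by (simp add: Vector_Spaces.linear_iff)

lemma bracket_add_right: "bracket x (y + z) = bracket x y + bracket x z"
  using linear_bracket_right by (simp add: Vector_Spaces.linear_iff)

lemma bracket_scale_left: "bracket (c *s x) y = c *s bracket x y"
  using linear_bracket_left by (simp add: Vector_Spaces.linear_iff)

lemma bracket_scale_right: "bracket x (c *s y) = c *s bracket x y"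
  using linear_bracket_right by (simp add: Vector_Spaces.linear_iff)

lemma bracket_zero_left [simp]: "bracket 0 x = 0"
  using bracket_scale_left[of 0] by simp

lemma bracket_zero_right [simp]: "bracket x 0 = 0"
  using bracket_scale_right[of _ 0] by simp

lemma bracket_minus_left: "bracket (- x) y = - bracket x y"
  using bracket_scale_left[of "- 1" x y] by simp

lemma bracket_minus_right: "bracket x (- y) = - bracket x y"
  using bracket_scale_right[of x "- 1" y] by simp

lemma bracket_anticomm: "bracket x y = - bracket y x"
proof -
  have "bracket (x + y) (x + y) = 0" by (rule bracket_self)
  then have "bracket x y + bracket y x = 0"
    unfolding bracket_add_left bracket_add_right by (simp add: bracket_self add.commute)
  then show ?thesis by (simp add: eq_neg_iff_add_eq_0)
qed

lemma bracket_sum_right: "bracket x (\<Sum>i\<in>I. f i) = (\<Sum>i\<in>I. bracket x (f i))"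
  by (induction I rule: infinite_finite_induct) (simp_all add: bracket_add_right)

text \<open>The Jacobi identity, rearranged by antisymmetry to say that \<open>bracket x\<close> is
  a derivation.\<close>

lemma leibniz: "bracket x (bracket y z) = bracket (bracket x y) z + bracket y (bracket x z)"
  using jacobi[of x y z] bracket_anticomm[of z "bracket x y"] bracket_anticomm[of z x]
  by (simp add: bracket_minus_right algebra_simps add_eq_0_iff2)

lemma subspace_kernel: "subspace {y. bracket x y = 0}"
  by (rule subspaceI) (simp_all add: bracket_add_right bracket_scale_right)

lemma subspace_annihilator: "subspace {x. bracket x y = 0}"
  by (rule subspaceI) (simp_all add: bracket_add_left bracket_scale_left)

lemma subspace_eigenspace: "subspace {y. bracket x y = c *s y}"
  by (rule subspaceI)
    (simp_all add: bracket_add_right bracket_scale_right scale_right_distrib scale_left_commute)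

lemma bracket_weight_space:
  assumes "x \<in> weight_space H \<alpha>" and "y \<in> weight_space H \<beta>"
  shows "bracket x y \<in> weight_space H (\<alpha> + \<beta>)"
  using assms
  by (auto simp: weight_space_def leibniz[of _ x y] bracket_scale_left bracket_scale_right
      scale_left_distrib)

lemma bracket_power_weight_space:
  assumes "x \<in> weight_space H \<alpha>" and "y \<in> weight_space H \<beta>"
  shows "(bracket x ^^ n) y \<in> weight_space H (\<beta> + form_scale (of_nat n) \<alpha>)"
proof (induction n)
  case 0
  have "\<beta> + form_scale (of_nat 0) \<alpha> = \<beta>" by (simp add: fun_eq_iff form_scale_def)
  then show ?case using assms(2) by simp
next
  case (Suc n)
  have "\<alpha> + (\<beta> + form_scale (of_nat n) \<alpha>) = \<beta> + form_scale (of_nat (Suc n)) \<alpha>"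
    by (simp add: fun_eq_iff form_scale_def algebra_simps)
  then show ?case using bracket_weight_space[OF assms(1) Suc.IH] by (simp only: funpow.simps o_apply)
qed

section \<open>Eigenvectors of a single adjoint map\<close>

lemma independent_eigenvectors:
  assumes "\<And>z. z \<in> S \<Longrightarrow> z \<noteq> 0 \<and> bracket x z = ev z *s z" and "inj_on ev S"
  shows "independent S"
proof -
  have "\<forall>z\<in>t. u z = 0" if "finite t" "t \<subseteq> S" "(\<Sum>z\<in>t. u z *s z) = 0" for t u
    using that
  proof (induction t arbitrary: u rule: finite_induct)
    case (insert a t)
    have ev: "bracket x z = ev z *s z" if "z \<in> insert a t" for z
      using that insert.prems(1) assms(1) by blast
    have sum0: "u a *s a + (\<Sum>z\<in>t. u z *s z) = 0" using insert by simp
    \<comment> \<open>Applying \<open>bracket x\<close> minus the scalar \<open>ev a\<close> kills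
      the term of \<open>a\<close> and multiplies each other term by a nonzero difference of
      eigenvalues.\<close>
    have "0 = bracket x (\<Sum>z\<in>insert a t. u z *s z) - ev a *s (\<Sum>z\<in>insert a t. u z *s z)"
      using insert.prems by simp
    also have "\<dots> = (\<Sum>z\<in>insert a t. (u z * (ev z - ev a)) *s z)"
      unfolding bracket_sum_right scale_sum_right sum_subtractf[symmetric]
      by (intro sum.cong refl)
        (simp add: ev bracket_scale_right scale_left_diff_distrib right_diff_distrib
          mult.commute)
    also have "\<dots> = (\<Sum>z\<in>t. (u z * (ev z - ev a)) *s z)" using insert.hyps by simp
    finally have "\<forall>z\<in>t. u z * (ev z - ev a) = 0"
      using insert.IH[of "\<lambda>z. u z * (ev z - ev a)"] insert.prems(1) by simp
    moreover have "ev z \<noteq> ev a" if "z \<in> t" for z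
      using that insert assms(2) by (metis inj_onD insertCI subsetD)
    ultimately have *: "\<forall>z\<in>t. u z = 0" by auto
    then have "u a *s a = 0" using sum0 by simp
    then show ?case using * assms(1)[of a] insert.prems by auto
  qed simp
  then show ?thesis unfolding independent_explicit_finite_subsets by blast
qed

text \<open>The vector \<open>v\<close> is a sum of eigenvectors. Applying \<open>bracket x\<close>
  minus the eigenvalue of one term removes that term and stays in \<open>V\<close>; if the outcome
  is zero, the sum reached so far is itself an eigenvector in \<open>V\<close>.\<close>

lemma exists_eigenvector:
  assumes "ad_semisimple x" and V: "subspace V" "\<And>v. v \<in> V \<Longrightarrow> bracket x v \<in> V"
    and "v \<in> V" "v \<noteq> 0"
  shows "\<exists>w\<in>V. w \<noteq> 0 \<and> (\<exists>c. bracket x w = c *s w)"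
proof -
  \<comment> \<open>Stated for families \<open>u\<close> rather than sets of eigenvectors, so that
    terms may be rescaled, coincide or vanish during the induction.\<close>
  have "\<exists>w\<in>V. w \<noteq> 0 \<and> (\<exists>c. bracket x w = c *s w)"
    if "finite t" "\<forall>z\<in>t. bracket x (u z) = ev z *s u z" "(\<Sum>z\<in>t. u z) \<in> V" "(\<Sum>z\<in>t. u z) \<noteq> 0"
    for t and u :: "'g \<Rightarrow> 'g" and ev
    using that
  proof (induction t arbitrary: u rule: finite_induct)
    case (insert a t)
    let ?v = "\<Sum>z\<in>insert a t. u z"
    let ?w = "bracket x ?v - ev a *s ?v"
    have "?w = (\<Sum>z\<in>insert a t. (ev z - ev a) *s u z)"
      unfolding bracket_sum_right scale_sum_right sum_subtractf[symmetric]
      using insert.prems(1) by (intro sum.cong) (auto simp: scale_left_diff_distrib)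
    then have w: "?w = (\<Sum>z\<in>t. (ev z - ev a) *s u z)" using insert.hyps by simp
    have "?w \<in> V" using V insert.prems(2) by (intro subspace_diff subspace_scale) auto
    show ?case
    proof (cases "?w = 0")
      case True
      then show ?thesis using insert.prems by auto
    next
      case False
      then show ?thesis
        using insert.IH[of "\<lambda>z. (ev z - ev a) *s u z"] insert.prems(1) w \<open>?w \<in> V\<close>
        by (simp add: bracket_scale_right scale_left_commute)
    qed
  qed simp
  note combination = this
  define E where "E = {y. \<exists>c. bracket x y = c *s y}"
  have "v \<in> span E" using assms(1) by (simp add: ad_semisimple_def E_def)
  then obtain t r where t: "finite t" "t \<subseteq> E" "v = (\<Sum>z\<in>t. r z *s z)"
    unfolding span_explicit by blast
  have "\<forall>z\<in>t. \<exists>c. bracket x z = c *s z" using t(2) by (auto simp: E_def)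
  then obtain ev where "\<forall>z\<in>t. bracket x z = ev z *s z" by metis
  then show ?thesis
    using assms(4,5) t(1,3) combination[of t "\<lambda>z. r z *s z" ev]
    by (simp add: bracket_scale_right scale_left_commute)
qed

section \<open>sl2-triples: weights, raising and lowering\<close>

definition sl2_triple :: "'g \<Rightarrow> 'g \<Rightarrow> 'g \<Rightarrow> bool" where
  "sl2_triple e h f \<longleftrightarrow> bracket h e = 2 *s e \<and> bracket h f = (- 2) *s f \<and> bracket e f = h"

text \<open>This symmetry turns every statement about lowering by \<open>f\<close> into one about
  raising by \<open>e\<close>.\<close>

lemma sl2_triple_swap: "sl2_triple e h f \<Longrightarrow> sl2_triple f (- h) e"
  by (auto simp: sl2_triple_def bracket_minus_left intro: bracket_anticomm)

lemma sl2_weight: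
  assumes "sl2_triple e h f" and "bracket h v = c *s v"
  shows "bracket h ((bracket f ^^ n) v) = (c - 2 * of_nat n) *s (bracket f ^^ n) v"
proof (induction n)
  case (Suc n)
  let ?w = "(bracket f ^^ n) v"
  have "bracket h (bracket f ?w) = bracket (bracket h f) ?w + bracket f (bracket h ?w)"
    by (rule leibniz)
  also have "\<dots> = (- 2) *s bracket f ?w + (c - 2 * of_nat n) *s bracket f ?w"
    using assms(1) by (simp add: Suc.IH sl2_triple_def bracket_scale_left bracket_scale_right
        bracket_minus_left)
  also have "\<dots> = (c - 2 * of_nat (Suc n)) *s bracket f ?w"
    unfolding scale_left_distrib[symmetric] by (simp add: algebra_simps)
  finally show ?case by simp
qed (use assms in simp)

text \<open>Induction with ef = fe + h as operators: each step adds the weight c - 2(n + 1) to the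
  coefficient (n + 1)(c - n), which yields (n + 2)(c - n - 1).\<close>

lemma sl2_raise_lower:
  assumes "sl2_triple e h f" and "bracket h v = c *s v" and "bracket e v = 0"
  shows "bracket e ((bracket f ^^ Suc n) v) =
    (of_nat (Suc n) * (c - of_nat n)) *s (bracket f ^^ n) v"
proof (induction n)
  case 0
  show ?case using assms leibniz[of e f v] by (simp add: sl2_triple_def)
next
  case (Suc n)
  let ?w = "(bracket f ^^ Suc n) v"
  have "bracket e (bracket f ?w) = bracket (bracket e f) ?w + bracket f (bracket e ?w)"
    by (rule leibniz)
  also have "\<dots> = (c - 2 * of_nat (Suc n)) *s ?w + (of_nat (Suc n) * (c - of_nat n)) *s ?w"
    using assms(1) sl2_weight[OF assms(1,2), of "Suc n"]
    unfolding Suc.IH sl2_triple_def by (simp add: bracket_scale_right)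
  also have "\<dots> = (of_nat (Suc (Suc n)) * (c - of_nat (Suc n))) *s ?w"
    unfolding scale_left_distrib[symmetric] by (simp add: algebra_simps)
  finally show ?case by simp
qed

end

section \<open>Finite-dimensional sl2-theory in characteristic zero\<close>

context simple_lie_algebra
begin

notation scale (infixr \<open>*s\<close> 75)

text \<open>The factor (n + 1)(N - n) from \<open>sl2_raise_lower\<close> does not vanish for n < N
  in characteristic zero, so \<open>e\<close> leads back from the next vector to a nonzero
  one.\<close>

lemma sl2_lower_nonzero:
  assumes "sl2_triple e h f" and "bracket h v = of_nat N *s v" and "bracket e v = 0"
    and "v \<noteq> 0" and "n \<le> N"
  shows "(bracket f ^^ n) v \<noteq> 0"
  using \<open>n \<le> N\<close>
proof (induction n)
  case (Suc n)
  have "of_nat N - of_nat n \<noteq> (0 :: 'k)"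
    using Suc.prems by simp
  then have "bracket e ((bracket f ^^ Suc n) v) \<noteq> 0"
    unfolding sl2_raise_lower[OF assms(1-3)] using Suc by (simp del: of_nat_Suc)
  then show ?case by auto
qed (use assms in simp)

lemma finite_independent: "independent S \<Longrightarrow> finite S"
  using finite_dimensional independent_span_bound[of _ S] by (metis subset_UNIV)

lemma eigenvalue_minus: "bracket (- h) v = c *s v \<Longrightarrow> bracket h v = (- c) *s v"
  by (metis bracket_minus_left minus_minus scale_minus_left)

text \<open>The vectors \<open>(bracket e ^^ k) x\<close> have pairwise different eigenvalues c + 2k
  under \<open>h\<close>; were all nonzero, they would form an infinite independent set. The vector
  before the first zero is the one sought.\<close>

lemma sl2_highest_vector:
  assumes triple: "sl2_triple e h f" and "bracket h x = c *s x" and "x \<noteq> 0"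
  shows "\<exists>k. (bracket e ^^ k) x \<noteq> 0 \<and> bracket e ((bracket e ^^ k) x) = 0"
proof -
  let ?v = "\<lambda>k. (bracket e ^^ k) x"
  have weight: "bracket h (?v k) = (c + 2 * of_nat k) *s ?v k" for k
    using eigenvalue_minus[OF sl2_weight[OF sl2_triple_swap[OF triple], of x "- c" k]] assms(2)
    by (simp add: bracket_minus_left add.commute)
  have "\<exists>n. ?v n = 0"
  proof (rule ccontr)
    assume "\<not> ?thesis"
    then have nz: "?v n \<noteq> 0" for n by blast
    have inj: "inj ?v"
    proof (rule injI)
      fix i j assume "?v i = ?v j"
      then have "(c + 2 * of_nat i) *s ?v i = (c + 2 * of_nat j) *s ?v i"
        using weight[of i] weight[of j] by metis
      then show "i = j" using nz[of i] by simp
    qed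
    \<comment> \<open>\<open>independent_eigenvectors\<close> takes eigenvalues as a function of the
      vector, so the exponent is recovered by inverting \<open>?v\<close>.\<close>
    define ev where "ev z = c + 2 * of_nat (inv ?v z)" for z
    have "independent (range ?v)"
    proof (rule independent_eigenvectors[of _ h ev])
      show "z \<noteq> 0 \<and> bracket h z = ev z *s z" if "z \<in> range ?v" for z
        using that nz weight by (auto simp: ev_def inv_f_f[OF inj])
      show "inj_on ev (range ?v)" by (auto simp: ev_def inv_f_f[OF inj] intro!: inj_onI)
    qed
    then show False using finite_independent inj finite_imageD by blast
  qed
  then obtain n where "?v n = 0" by blast
  then show ?thesis
    using ex_least_nat_less[of "\<lambda>n. ?v n = 0" n] assms(3) by auto
qed

text \<open>Raise \<open>x\<close> by \<open>k\<close> steps to a highest vector, of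
  \<open>h\<close>-eigenvalue m + 2k, then lower it m + k times. The result is nonzero because m + k
  \<le> m + 2k, and its weight is \<beta> + k\<alpha> - (m + k)\<alpha>.\<close>

lemma sl2_lower_weight:
  assumes triple: "sl2_triple e h f" and e: "e \<in> weight_space H \<alpha>" and f: "f \<in> weight_space H (- \<alpha>)"
    and x: "x \<in> weight_space H \<beta>" "x \<noteq> 0" "bracket h x = of_nat m *s x"
  shows "\<exists>y. y \<noteq> 0 \<and> y \<in> weight_space H (\<beta> - form_scale (of_nat m) \<alpha>)"
proof -
  obtain k where k: "(bracket e ^^ k) x \<noteq> 0" "bracket e ((bracket e ^^ k) x) = 0"
    using sl2_highest_vector[OF triple x(3,2)] by blast
  let ?v = "(bracket e ^^ k) x"
  have "bracket (- h) ?v = (- of_nat m - 2 * of_nat k) *s ?v"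
    using x(3) by (intro sl2_weight[OF sl2_triple_swap[OF triple]]) (simp add: bracket_minus_left)
  from eigenvalue_minus[OF this] have "bracket h ?v = of_nat (m + 2 * k) *s ?v"
    by (simp add: add.commute)
  then have "(bracket f ^^ (m + k)) ?v \<noteq> 0"
    by (rule sl2_lower_nonzero[OF triple _ k(2,1)]) simp
  moreover have "(bracket f ^^ (m + k)) ?v \<in>
      weight_space H ((\<beta> + form_scale (of_nat k) \<alpha>) + form_scale (of_nat (m + k)) (- \<alpha>))"
    using bracket_power_weight_space e f x(1) by blast
  moreover have "(\<beta> + form_scale (of_nat k) \<alpha>) + form_scale (of_nat (m + k)) (- \<alpha>) =
      \<beta> - form_scale (of_nat m) \<alpha>"
    by (simp add: fun_eq_iff form_scale_def algebra_simps)
  ultimately show ?thesis by metis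
qed

end

section \<open>Weight spaces of a Cartan subalgebra\<close>

locale cartan_decomposition = simple_lie_algebra scale bracket
  for scale :: "'k::{alg_closed_field, field_char_0} \<Rightarrow> 'g::ab_group_add \<Rightarrow> 'g" (infixr \<open>*s\<close> 75)
    and bracket :: "'g \<Rightarrow> 'g \<Rightarrow> 'g" +
  fixes H :: "'g set"
  assumes cartan: "cartan_subalgebra H"
begin

lemma subspace_H: "subspace H"
  using cartan by (simp add: cartan_subalgebra_def abelian_subalgebra_def)

lemma bracket_H: "x \<in> H \<Longrightarrow> y \<in> H \<Longrightarrow> bracket x y = 0"
  using cartan by (simp add: cartan_subalgebra_def abelian_subalgebra_def)

text \<open>Adjoining \<open>x\<close> to \<open>H\<close> spans an abelian subalgebra, which equals
  \<open>H\<close> by maximality. Commutation passes from generators to the span one argument at a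
  time.\<close>

lemma centralizer_H:
  assumes "\<And>h. h \<in> H \<Longrightarrow> bracket h x = 0"
  shows "x \<in> H"
proof -
  let ?K = "span (insert x H)"
  have comm: "bracket u v = 0" if "u \<in> insert x H" "v \<in> insert x H" for u v
    using that assms bracket_H bracket_self bracket_anticomm[of x v] by auto
  have 1: "bracket u v = 0" if "u \<in> insert x H" "v \<in> ?K" for u v
    using that(2) subspace_kernel[of u] comm[OF that(1)]
    by (metis (mono_tags, lifting) mem_Collect_eq span_induct)
  have "bracket u v = 0" if "u \<in> ?K" "v \<in> ?K" for u v
    using that(1) subspace_annihilator[of v] 1[OF _ that(2)]
    by (metis (mono_tags, lifting) mem_Collect_eq span_induct)
  then have "abelian_subalgebra ?K" by (simp add: abelian_subalgebra_def)
  moreover have "H \<subseteq> ?K" using span_superset[of "insert x H"] by blast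
  ultimately have "?K = H" using cartan by (simp add: cartan_subalgebra_def)
  then show ?thesis using span_base[of x "insert x H"] by blast
qed

lemma weight_space_0: "weight_space H 0 = H"
  using bracket_H centralizer_H by (auto simp: weight_space_def)

lemma weight_spaceD: "x \<in> weight_space H \<alpha> \<Longrightarrow> h \<in> H \<Longrightarrow> bracket h x = \<alpha> h *s x"
  by (simp add: weight_space_def)

lemma zero_in_weight_space: "0 \<in> weight_space H \<alpha>"
  by (simp add: weight_space_def)

lemma coroot_in_H:
  assumes "e \<in> weight_space H \<alpha>" and "f \<in> weight_space H (- \<alpha>)"
  shows "bracket e f \<in> H"
proof -
  have "bracket e f \<in> weight_space H (\<alpha> + - \<alpha>)" by (rule bracket_weight_space[OF assms])
  then show ?thesis by (simp add: weight_space_0)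
qed

lemma root_sl2_triple:
  assumes "e \<in> weight_space H \<alpha>" and "f \<in> weight_space H (- \<alpha>)" and "\<alpha> (bracket e f) = 2"
  shows "sl2_triple e (bracket e f) f"
  using weight_spaceD[OF assms(1) coroot_in_H[OF assms(1,2)]]
    weight_spaceD[OF assms(2) coroot_in_H[OF assms(1,2)]] assms(3)
  by (simp add: sl2_triple_def)

text \<open>The reflection of \<beta> in \<alpha> is again a weight. For m \<ge> 0 it is reached by
  lowering; for m < 0 the triple with \<open>e\<close> and \<open>f\<close> exchanged does the same
  with -\<alpha> and -m.\<close>

lemma reflect_weight:
  assumes e: "e \<in> weight_space H \<alpha>" and f: "f \<in> weight_space H (- \<alpha>)" and h: "\<alpha> (bracket e f) = 2"
    and \<beta>: "weight_space H \<beta> \<noteq> {0}" "\<beta> (bracket e f) = of_int m"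
  shows "weight_space H (\<beta> - form_scale (of_int m) \<alpha>) \<noteq> {0}"
proof -
  note triple = root_sl2_triple[OF e f h]
  obtain x where x: "x \<in> weight_space H \<beta>" "x \<noteq> 0" using \<beta>(1) zero_in_weight_space by blast
  have hx: "bracket (bracket e f) x = of_int m *s x"
    using weight_spaceD[OF x(1) coroot_in_H[OF e f]] \<beta>(2) by simp
  have "\<exists>y. y \<noteq> 0 \<and> y \<in> weight_space H (\<beta> - form_scale (of_int m) \<alpha>)"
  proof (cases "0 \<le> m")
    case True
    then show ?thesis using sl2_lower_weight[OF triple e f x, of "nat m"] hx by simp
  next
    case False
    have "e \<in> weight_space H (- (- \<alpha>))" using e by simp
    moreover have "\<beta> - form_scale (of_nat (nat (- m))) (- \<alpha>) = \<beta> - form_scale (of_int m) \<alpha>"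
      using False by (simp add: fun_eq_iff form_scale_def)
    ultimately show ?thesis
      using sl2_lower_weight[OF sl2_triple_swap[OF triple] f _ x, of "nat (- m)"] hx False
      by (simp add: bracket_minus_left)
  qed
  then show ?thesis by blast
qed

text \<open>A highest vector of weight \<open>n\<alpha>\<close>, \<open>n \<ge> 2\<close>, would be lowered into \<open>H\<close>, and \<open>e\<close> maps \<open>H\<close> into the
  line of \<open>e\<close>; but raising that line once more gives zero.\<close>

lemma no_multiple_root:
  assumes e: "e \<in> weight_space H \<alpha>" and f: "f \<in> weight_space H (- \<alpha>)" and h: "\<alpha> (bracket e f) = 2"
    and "2 \<le> k"
  shows "weight_space H (form_scale (of_nat k) \<alpha>) = {0}"
proof (rule ccontr)
  note triple = root_sl2_triple[OF e f h]
  let ?h = "bracket e f"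
  assume "\<not> ?thesis"
  then obtain x where x: "x \<in> weight_space H (form_scale (of_nat k) \<alpha>)" "x \<noteq> 0"
    using zero_in_weight_space by blast
  have "bracket ?h x = form_scale (of_nat k) \<alpha> ?h *s x"
    by (rule weight_spaceD[OF x(1) coroot_in_H[OF e f]])
  then obtain r where r: "(bracket e ^^ r) x \<noteq> 0" "bracket e ((bracket e ^^ r) x) = 0"
    using sl2_highest_vector[OF triple _ x(2)] by blast
  define v where "v = (bracket e ^^ r) x"
  have "v \<in> weight_space H (form_scale (of_nat k) \<alpha> + form_scale (of_nat r) \<alpha>)"
    unfolding v_def by (rule bracket_power_weight_space[OF e x(1)])
  moreover have "form_scale (of_nat k) \<alpha> + form_scale (of_nat r) \<alpha> = form_scale (of_nat (k + r)) \<alpha>"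
    by (simp add: fun_eq_iff form_scale_def algebra_simps)
  ultimately have v: "v \<in> weight_space H (form_scale (of_nat (k + r)) \<alpha>)" by simp
  \<comment> \<open>The offset makes the vectors \<open>?w n\<close>, \<open>?w (Suc n)\<close> and
    \<open>?w (Suc (Suc n))\<close> have weights 2\<alpha>, \<alpha> and 0; it exists because k
    \<ge> 2.\<close>
  obtain n where n: "k + r = Suc (Suc n)" using \<open>2 \<le> k\<close> by (metis add_2_eq_Suc le_Suc_ex add.assoc)
  have hv: "bracket ?h v = of_nat (2 * Suc (Suc n)) *s v"
    using weight_spaceD[OF v coroot_in_H[OF e f]] h n by (simp add: form_scale_def mult.commute)
  have ev: "bracket e v = 0" and nz: "v \<noteq> 0" using r by (simp_all add: v_def)
  let ?w = "\<lambda>i. (bracket f ^^ i) v"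
  have w_nz: "?w i \<noteq> 0" if "i \<le> 2 * Suc (Suc n)" for i
    using sl2_lower_nonzero[OF triple hv ev nz that] .
  have raise: "\<exists>c. c \<noteq> 0 \<and> bracket e (?w (Suc i)) = c *s ?w i" if "i \<le> Suc n" for i
  proof -
    have "of_nat (2 * Suc (Suc n)) - of_nat i = (of_nat (2 * Suc (Suc n) - i) :: 'k)"
      using that by (subst of_nat_diff) auto
    moreover have "(of_nat (2 * Suc (Suc n) - i) :: 'k) \<noteq> 0"
      unfolding of_nat_eq_0_iff using that by simp
    ultimately have "of_nat (Suc i) * (of_nat (2 * Suc (Suc n)) - of_nat i) \<noteq> (0 :: 'k)"
      by (simp del: of_nat_Suc)
    then show ?thesis using sl2_raise_lower[OF triple hv ev, of i] by blast
  qed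
  have "?w (Suc (Suc n)) \<in> weight_space H
      (form_scale (of_nat (k + r)) \<alpha> + form_scale (of_nat (Suc (Suc n))) (- \<alpha>))"
    by (rule bracket_power_weight_space[OF f v])
  moreover have "form_scale (of_nat (k + r)) \<alpha> + form_scale (of_nat (Suc (Suc n))) (- \<alpha>) = 0"
    unfolding n by (simp add: fun_eq_iff form_scale_def)
  ultimately have wH: "?w (Suc (Suc n)) \<in> H" by (simp add: weight_space_0)
  obtain c where c: "c \<noteq> 0" "bracket e (?w (Suc (Suc n))) = c *s ?w (Suc n)"
    using raise[of "Suc n"] by auto
  have "bracket e (?w (Suc (Suc n))) = - (\<alpha> (?w (Suc (Suc n))) *s e)"
    using bracket_anticomm[of e] weight_spaceD[OF e wH] by metis
  then have "bracket e (c *s ?w (Suc n)) = 0"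
    using c(2) by (metis bracket_minus_right bracket_scale_right bracket_self minus_zero scale_zero_right)
  then have "bracket e (?w (Suc n)) = 0" using c(1) by (simp add: bracket_scale_right)
  moreover obtain c' where "c' \<noteq> 0" "bracket e (?w (Suc n)) = c' *s ?w n" using raise[of n] by auto
  ultimately show False using w_nz[of n] by auto
qed

text \<open>Run through a basis of \<open>H\<close>, cutting \<open>V\<close> down to nonzero
  \<open>H\<close>-stable subspaces on which one more basis element acts by a scalar. Semisimplicity
  supplies the eigenvector that keeps each cut nonzero.\<close>

lemma common_eigenvector:
  assumes V: "subspace V" "\<forall>h\<in>H. \<forall>v\<in>V. bracket h v \<in> V" and v: "v \<in> V" "v \<noteq> 0"
  shows "\<exists>x\<in>V. x \<noteq> 0 \<and> (\<exists>\<alpha>\<in>dual H. x \<in> weight_space H \<alpha>)"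
proof -
  have "\<exists>U\<subseteq>V. subspace U \<and> (\<forall>h\<in>H. \<forall>v\<in>U. bracket h v \<in> U) \<and> (\<exists>u\<in>U. u \<noteq> 0) \<and>
      (\<forall>b\<in>B. \<exists>c. \<forall>u\<in>U. bracket b u = c *s u)" if "finite B" "B \<subseteq> H" for B
    using that
  proof (induction B rule: finite_induct)
    case empty
    then show ?case using V v by blast
  next
    case (insert b B)
    then obtain U where U: "U \<subseteq> V" "subspace U" "\<forall>h\<in>H. \<forall>v\<in>U. bracket h v \<in> U" "\<exists>u\<in>U. u \<noteq> 0"
        "\<forall>b\<in>B. \<exists>c. \<forall>u\<in>U. bracket b u = c *s u"
      by auto
    have b: "b \<in> H" "ad_semisimple b"
      using insert.prems cartan by (auto simp: cartan_subalgebra_def)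
    then obtain w c where w: "w \<in> U" "w \<noteq> 0" "bracket b w = c *s w"
      using exists_eigenvector[of b U] U by blast
    \<comment> \<open>Invariance under \<open>H\<close> survives the cut because \<open>b\<close>
      commutes with every element of \<open>H\<close>.\<close>
    define U' where "U' = U \<inter> {u. bracket b u = c *s u}"
    have "subspace U'"
      unfolding U'_def by (intro subspace_inter U(2) subspace_eigenspace)
    moreover have "bracket h u \<in> U'" if "h \<in> H" "u \<in> U'" for h u
      using that U(3) leibniz[of b h u] bracket_H[OF b(1) that(1)]
      by (simp add: U'_def bracket_scale_right)
    moreover have "w \<in> U'" using w by (simp add: U'_def)
    ultimately show ?case
      using U(1,5) w(2) by (intro exI[of _ U']) (auto simp: U'_def)
  qed
  note simultaneous = this
  obtain B where B: "B \<subseteq> H" "independent B" "H \<subseteq> span B" "card B = dim H"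
    by (rule basis_exists)
  obtain U where U: "U \<subseteq> V" "\<exists>u\<in>U. u \<noteq> 0" "\<forall>b\<in>B. \<exists>c. \<forall>u\<in>U. bracket b u = c *s u"
    using simultaneous[OF finite_independent[OF B(2)] B(1)] by auto
  then obtain x where "x \<in> U" "x \<noteq> 0" by blast
  then have x: "x \<in> V" "x \<noteq> 0" "\<forall>b\<in>B. \<exists>c. bracket b x = c *s x"
    using U by blast+
  have "subspace {h. \<exists>c. bracket h x = c *s x}"
  proof (rule subspaceI)
    show "0 \<in> {h. \<exists>c. bracket h x = c *s x}" by (auto intro: exI[of _ 0])
  next
    fix g h assume "g \<in> {h. \<exists>c. bracket h x = c *s x}" "h \<in> {h. \<exists>c. bracket h x = c *s x}"
    then show "g + h \<in> {h. \<exists>c. bracket h x = c *s x}"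
      by (auto simp: bracket_add_left scale_left_distrib[symmetric])
  next
    fix a h assume "h \<in> {h. \<exists>c. bracket h x = c *s x}"
    then show "a *s h \<in> {h. \<exists>c. bracket h x = c *s x}" by (auto simp: bracket_scale_left)
  qed
  then have "span B \<subseteq> {h. \<exists>c. bracket h x = c *s x}" using x(3) by (intro span_minimal) auto
  then have "\<exists>c. bracket h x = c *s x" if "h \<in> H" for h using that B(3) by blast
  then obtain c where c: "\<And>h. h \<in> H \<Longrightarrow> bracket h x = c h *s x" by metis
  \<comment> \<open>Zero off \<open>H\<close>, as \<open>dual H\<close> demands. On \<open>H\<close>
    the map \<open>c\<close> is linear because the eigenvalue of a nonzero vector is unique.\<close>
  define \<alpha> where "\<alpha> h = (if h \<in> H then c h else 0)" for h
  have "\<alpha> \<in> dual H"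
  proof -
    have "c (g + h) = c g + c h" if "g \<in> H" "h \<in> H" for g h
    proof -
      have "c (g + h) *s x = (c g + c h) *s x"
        using that c subspace_add[OF subspace_H that] bracket_add_left[of g h x]
        by (simp add: scale_left_distrib)
      then show ?thesis using x(2) by simp
    qed
    moreover have "c (a *s h) = a * c h" if "h \<in> H" for a h
    proof -
      have "c (a *s h) *s x = (a * c h) *s x"
        using that c subspace_scale[OF subspace_H that] bracket_scale_left[of a h x] by simp
      then show ?thesis using x(2) by simp
    qed
    ultimately show ?thesis
      using subspace_add[OF subspace_H] subspace_scale[OF subspace_H]
      by (simp add: dual_def \<alpha>_def)
  qed
  moreover have "x \<in> weight_space H \<alpha>" using c by (simp add: weight_space_def \<alpha>_def)
  ultimately show ?thesis using x by blast
qed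

text \<open>The center is an ideal, and it is proper because some bracket is nonzero.\<close>

lemma center_trivial:
  assumes "\<And>x. bracket y x = 0"
  shows "y = 0"
proof -
  let ?Z = "{y. \<forall>x. bracket y x = 0}"
  have "subspace ?Z"
    by (rule subspaceI) (simp_all add: bracket_add_left bracket_scale_left)
  moreover have "bracket x z \<in> ?Z" if "z \<in> ?Z" for x z
    using that bracket_anticomm[of x z] by simp
  ultimately have "lie_ideal ?Z" by (simp add: lie_ideal_def)
  moreover have "?Z \<noteq> UNIV" using nonabelian by auto
  ultimately have "?Z = {0}" using ideal_trivial by blast
  then show ?thesis using assms by blast
qed

text \<open>An eigenspace of \<open>bracket y\<close> with eigenvalue c \<noteq> 0 is
  \<open>H\<close>-stable, so it would contain a common eigenvector of \<open>H\<close>, whose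
  weight is a root with value c at \<open>y\<close>. Hence \<open>bracket y\<close> kills all its
  eigenvectors; these span, and \<open>y\<close> is central.\<close>

lemma roots_separate:
  assumes y: "y \<in> H" "\<forall>\<alpha>\<in>roots H. \<alpha> y = 0"
  shows "y = 0"
proof -
  have "bracket y x = 0" for x
  proof -
    have "bracket y z = 0" if z: "bracket y z = c *s z" for z c
    proof (rule ccontr)
      assume nz: "bracket y z \<noteq> 0"
      let ?V = "{v. bracket y v = c *s v}"
      have "bracket h v \<in> ?V" if "h \<in> H" "v \<in> ?V" for h v
        using that leibniz[of y h v] bracket_H[OF y(1) that(1)] by (simp add: bracket_scale_right)
      moreover have "z \<in> ?V" "z \<noteq> 0" using z nz by auto
      ultimately obtain x \<alpha> where x: "x \<in> ?V" "x \<noteq> 0" "\<alpha> \<in> dual H" "x \<in> weight_space H \<alpha>"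
        using common_eigenvector[OF subspace_eigenspace] by meson
      then have "\<alpha> y *s x = c *s x" using weight_spaceD[OF x(4) y(1)] by simp
      then have "\<alpha> y = c" using x(2) by simp
      moreover have "c \<noteq> 0" using nz z by auto
      ultimately have "\<alpha> \<in> roots H" using x by (auto simp: roots_def)
      then show False using y(2) \<open>\<alpha> y = c\<close> \<open>c \<noteq> 0\<close> by blast
    qed
    then have "{z. \<exists>c. bracket y z = c *s z} \<subseteq> {z. bracket y z = 0}" by blast
    then have "span {z. \<exists>c. bracket y z = c *s z} \<subseteq> {z. bracket y z = 0}"
      by (rule span_minimal[OF _ subspace_kernel])
    moreover have "span {z. \<exists>c. bracket y z = c *s z} = UNIV"
      using cartan y(1) by (simp add: cartan_subalgebra_def ad_semisimple_def)
    ultimately show ?thesis by blast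
  qed
  then show ?thesis by (rule center_trivial)
qed

end

section \<open>Linear forms on H\<close>

context lie_algebra
begin

lemma dual_add: "\<alpha> \<in> dual H \<Longrightarrow> x \<in> H \<Longrightarrow> y \<in> H \<Longrightarrow> \<alpha> (x + y) = \<alpha> x + \<alpha> y"
  by (simp add: dual_def)

lemma dual_scale: "\<alpha> \<in> dual H \<Longrightarrow> x \<in> H \<Longrightarrow> \<alpha> (c *s x) = c * \<alpha> x"
  by (simp add: dual_def)

lemma dual_diff:
  assumes "\<alpha> \<in> dual H" and "subspace H" and "x \<in> H" and "y \<in> H"
  shows "\<alpha> (x - y) = \<alpha> x - \<alpha> y"
  using dual_add[OF assms(1), of "x - y" y] assms by (simp add: subspace_diff)

lemma dual_sum_vectors:
  assumes "\<alpha> \<in> dual H" and "subspace H" and "\<And>i. i \<in> I \<Longrightarrow> x i \<in> H"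
  shows "\<alpha> (\<Sum>i\<in>I. x i) = (\<Sum>i\<in>I. \<alpha> (x i))"
  using assms(3)
proof (induction I rule: infinite_finite_induct)
  case (insert i I)
  then have "(\<Sum>i\<in>I. x i) \<in> H" using assms(2) by (intro subspace_sum) auto
  then show ?case using insert dual_add[OF assms(1)] by simp
qed (use dual_scale[OF assms(1) subspace_0[OF assms(2)], of 0] in simp_all)

lemma dual_comb:
  assumes "\<And>i. i \<in> I \<Longrightarrow> \<beta> i \<in> dual H"
  shows "(\<Sum>i\<in>I. form_scale (c i) (\<beta> i)) \<in> dual H"
  using assms
  by (auto simp: dual_def sum_fun_apply form_scale_def sum.distrib[symmetric] sum_distrib_left
      algebra_simps intro!: sum.neutral sum.cong)

lemma module_form_scale: "module (form_scale :: 'k \<Rightarrow> ('g \<Rightarrow> 'k) \<Rightarrow> 'g \<Rightarrow> 'k)"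
  by unfold_locales (simp_all add: fun_eq_iff form_scale_def algebra_simps)

end

section \<open>Coordinates of the positive roots\<close>

text \<open>The parameters are witnesses for \<open>has_cartan_matrix\<close>: an enumeration of
  \<Pi> by the row indices of \<open>C\<close>, and one coroot per index.\<close>

locale based_root_system = cartan_decomposition scale bracket H
  for scale :: "'k::{alg_closed_field, field_char_0} \<Rightarrow> 'g::ab_group_add \<Rightarrow> 'g" (infixr \<open>*s\<close> 75)
    and bracket :: "'g \<Rightarrow> 'g \<Rightarrow> 'g" and H :: "'g set" +
  fixes \<Pi> :: "('g \<Rightarrow> 'k) set" and C :: "int list list" and \<alpha> :: "nat \<Rightarrow> 'g \<Rightarrow> 'k"
    and h :: "nat \<Rightarrow> 'g"
  assumes simple: "simple_roots H \<Pi>" and enum: "bij_betw \<alpha> {..<length C} \<Pi>"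
    and coroot: "j < length C \<Longrightarrow> is_coroot H (\<alpha> j) (h j)"
    and pairing: "i < length C \<Longrightarrow> j < length C \<Longrightarrow> \<alpha> i (h j) = of_int (C ! i ! j)"
begin

abbreviation n :: nat where "n \<equiv> length C"

definition root_comb :: "int list \<Rightarrow> 'g \<Rightarrow> 'k" where
  "root_comb v = (\<Sum>i<n. form_scale (of_int (v ! i)) (\<alpha> i))"

definition root_vecs :: "int list set" where
  "root_vecs = {v. length v = n \<and> (\<forall>x\<in>set v. 0 \<le> x) \<and> root_comb v \<in> roots H}"

lemma simple_root: "i < n \<Longrightarrow> \<alpha> i \<in> roots H"
  using simple enum by (auto simp: simple_roots_def bij_betw_def)

lemma simple_root_dual: "i < n \<Longrightarrow> \<alpha> i \<in> dual H"
  using simple_root by (auto simp: roots_def)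

lemma root_comb_apply: "root_comb v x = (\<Sum>i<n. of_int (v ! i) * \<alpha> i x)"
  by (simp add: root_comb_def sum_fun_apply form_scale_def)

lemma root_comb_dual: "root_comb v \<in> dual H"
  unfolding root_comb_def by (rule dual_comb) (simp add: simple_root_dual)

lemma coroot_bracket:
  assumes "j < n"
  obtains e f where "e \<in> weight_space H (\<alpha> j)" "f \<in> weight_space H (- \<alpha> j)" "bracket e f = h j"
    "\<alpha> j (bracket e f) = 2"
  using coroot[OF assms] by (auto simp: is_coroot_def)

lemma coroot_H: "j < n \<Longrightarrow> h j \<in> H"
  using coroot_bracket coroot_in_H by metis

lemma cartan_diagonal: "j < n \<Longrightarrow> C ! j ! j = 2"
proof -
  assume j: "j < n"
  then have "of_int (C ! j ! j) = (of_int 2 :: 'k)"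
    using pairing[OF j j] coroot[OF j] by (simp add: is_coroot_def)
  then show ?thesis by (simp only: of_int_eq_iff)
qed

lemma simple_independent:
  assumes "(\<Sum>i<n. form_scale (c i) (\<alpha> i)) = 0" and "i < n"
  shows "c i = 0"
proof -
  let ?idx = "the_inv_into {..<n} \<alpha>"
  have inj: "inj_on \<alpha> {..<n}" using enum by (simp add: bij_betw_def)
  have "(\<Sum>\<beta>\<in>\<Pi>. form_scale (c (?idx \<beta>)) \<beta>) = (\<Sum>i<n. form_scale (c i) (\<alpha> i))"
    unfolding sum.reindex_bij_betw[OF enum, symmetric]
    by (intro sum.cong) (auto simp: the_inv_into_f_f[OF inj])
  then have "(\<Sum>\<beta>\<in>\<Pi>. form_scale (c (?idx \<beta>)) \<beta>) = 0" using assms(1) by simp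
  moreover have "\<alpha> i \<in> \<Pi>" using enum assms(2) by (auto simp: bij_betw_def)
  moreover have "\<not> module.dependent form_scale \<Pi>" "finite \<Pi>"
    using simple by (simp_all add: simple_roots_def)
  ultimately have "c (?idx (\<alpha> i)) = 0"
    using module.independentD[OF module_form_scale, of \<Pi> \<Pi> "\<lambda>\<beta>. c (?idx \<beta>)" "\<alpha> i"] by simp
  then show ?thesis using assms(2) by (simp add: the_inv_into_f_f[OF inj])
qed

text \<open>Independence makes the coordinate differences vanish as scalars, and characteristic zero
  makes them vanish as integers.\<close>

lemma root_comb_inj:
  assumes "length v = n" and "length w = n" and "root_comb v = root_comb w"
  shows "v = w"
proof (rule nth_equalityI)
  fix i assume "i < length v"
  then have i: "i < n" using assms(1) by simp
  have "(\<Sum>i<n. form_scale (of_int (v ! i - w ! i)) (\<alpha> i)) = root_comb v - root_comb w"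
    by (simp add: fun_eq_iff root_comb_def sum_fun_apply form_scale_def sum_subtractf[symmetric]
        left_diff_distrib)
  then have "of_int (v ! i - w ! i) = (0 :: 'k)"
    using simple_independent[OF _ i, of "\<lambda>i. of_int (v ! i - w ! i)"] assms(3) by simp
  then show "v ! i = w ! i" by simp
qed (use assms in simp)

lemma root_comb_minus: "length v = n \<Longrightarrow> root_comb (map uminus v) = - root_comb v"
  by (simp add: fun_eq_iff root_comb_apply sum_negf[symmetric])

lemma root_comb_diff:
  "length v = n \<Longrightarrow> length w = n \<Longrightarrow> root_comb (map2 (-) v w) = root_comb v - root_comb w"
  by (simp add: fun_eq_iff root_comb_apply sum_subtractf[symmetric] left_diff_distrib)

lemma root_comb_replicate_0: "root_comb (replicate n 0) = 0"
  by (simp add: fun_eq_iff root_comb_apply)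

lemma root_comb_simple_vec: "j < n \<Longrightarrow> root_comb (simple_vec n j) = \<alpha> j"
proof -
  assume j: "j < n"
  have "root_comb (simple_vec n j) x = (\<Sum>i<n. if i = j then \<alpha> i x else 0)" for x
    unfolding root_comb_apply by (intro sum.cong) (auto simp: nth_simple_vec)
  then show ?thesis using j by (simp add: fun_eq_iff)
qed

lemma root_comb_coroot: "j < n \<Longrightarrow> root_comb v (h j) = of_int (coroot_pairing C j v)"
  by (simp add: root_comb_apply coroot_pairing_eq_sum pairing)

lemma root_comb_reflect:
  assumes "j < n" and "length v = n"
  shows "root_comb (reflect C j v) =
    root_comb v - form_scale (of_int (coroot_pairing C j v)) (\<alpha> j)"
proof
  fix x
  have "root_comb (reflect C j v) x =
      (\<Sum>i<n. of_int (v ! i) * \<alpha> i x - (if i = j then of_int (coroot_pairing C j v) * \<alpha> i x else 0))"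
    unfolding root_comb_apply using assms
    by (intro sum.cong) (auto simp: reflect_nth left_diff_distrib)
  also have "\<dots> = root_comb v x - of_int (coroot_pairing C j v) * \<alpha> j x"
    using assms(1) by (simp add: sum_subtractf root_comb_apply)
  finally show "root_comb (reflect C j v) x =
      (root_comb v - form_scale (of_int (coroot_pairing C j v)) (\<alpha> j)) x"
    by (simp add: form_scale_def)
qed

section \<open>Positivity and the root order in coordinates\<close>

lemma nonneg_comb_iff:
  "nonneg_comb \<Pi> \<mu> \<longleftrightarrow> (\<exists>v. length v = n \<and> (\<forall>x\<in>set v. 0 \<le> x) \<and> \<mu> = root_comb v)"
proof
  assume "nonneg_comb \<Pi> \<mu>"
  then obtain m :: "('g \<Rightarrow> 'k) \<Rightarrow> nat" where m: "\<mu> = (\<Sum>\<beta>\<in>\<Pi>. form_scale (of_nat (m \<beta>)) \<beta>)"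
    by (auto simp: nonneg_comb_def)
  have "\<mu> = root_comb (map (\<lambda>i. int (m (\<alpha> i))) [0..<n])"
    unfolding m sum.reindex_bij_betw[OF enum, symmetric] root_comb_def by (intro sum.cong) auto
  then show "\<exists>v. length v = n \<and> (\<forall>x\<in>set v. 0 \<le> x) \<and> \<mu> = root_comb v"
    by (intro exI[of _ "map (\<lambda>i. int (m (\<alpha> i))) [0..<n]"]) auto
next
  assume "\<exists>v. length v = n \<and> (\<forall>x\<in>set v. 0 \<le> x) \<and> \<mu> = root_comb v"
  then obtain v where v: "length v = n" "\<forall>x\<in>set v. 0 \<le> x" "\<mu> = root_comb v" by blast
  let ?m = "\<lambda>\<beta>. nat (v ! the_inv_into {..<n} \<alpha> \<beta>)"
  have inj: "inj_on \<alpha> {..<n}" using enum by (simp add: bij_betw_def)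
  have "\<mu> = (\<Sum>\<beta>\<in>\<Pi>. form_scale (of_nat (?m \<beta>)) \<beta>)"
    unfolding v(3) sum.reindex_bij_betw[OF enum, symmetric] root_comb_def using v(1,2)
    by (intro sum.cong) (auto simp: the_inv_into_f_f[OF inj])
  then show "nonneg_comb \<Pi> \<mu>" unfolding nonneg_comb_def by (rule exI[of _ ?m])
qed

lemma nonneg_comb_root_comb:
  "length v = n \<Longrightarrow> nonneg_comb \<Pi> (root_comb v) \<longleftrightarrow> (\<forall>x\<in>set v. 0 \<le> x)"
  using nonneg_comb_iff root_comb_inj by blast

lemma positive_roots_eq: "positive_roots H \<Pi> = root_comb ` root_vecs"
  by (auto simp: positive_roots_def root_vecs_def nonneg_comb_iff)

lemma root_le_root_comb:
  assumes "length v = n" and "length w = n"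
  shows "root_le \<Pi> (root_comb v) (root_comb w) \<longleftrightarrow> vec_le v w"
proof -
  have "root_le \<Pi> (root_comb v) (root_comb w) \<longleftrightarrow> (\<forall>x\<in>set (map2 (-) w v). 0 \<le> x)"
    using assms by (simp add: root_le_def root_comb_diff[symmetric] nonneg_comb_root_comb)
  also have "\<dots> \<longleftrightarrow> (\<forall>i<n. v ! i \<le> w ! i)"
    using assms by (simp add: all_set_conv_all_nth)
  also have "\<dots> \<longleftrightarrow> vec_le v w"
    using assms by (simp add: vec_le_eq_list_all2 list_all2_conv_all_nth)
  finally show ?thesis .
qed

text \<open>Otherwise the root is a multiple of the j-th simple root. Factor 0 gives no root, factor
  1 is excluded by hypothesis, and factors from 2 on by \<open>no_multiple_root\<close>.\<close>

lemma root_vec_other_coordinate: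
  assumes v: "v \<in> root_vecs" and j: "j < n" and "v \<noteq> simple_vec n j"
  shows "\<exists>i<n. i \<noteq> j \<and> 0 < v ! i"
proof (rule ccontr)
  assume "\<not> ?thesis"
  then have zero: "v ! i = 0" if "i < n" "i \<noteq> j" for i
    using that v by (force simp: root_vecs_def order_le_less)
  have len: "length v = n" and root: "root_comb v \<in> roots H" and nonneg: "0 \<le> v ! j"
    using v j by (auto simp: root_vecs_def)
  have comb: "root_comb v = form_scale (of_nat (nat (v ! j))) (\<alpha> j)"
  proof
    fix x
    have "root_comb v x = (\<Sum>i<n. if i = j then of_int (v ! i) * \<alpha> i x else 0)"
      unfolding root_comb_apply using zero by (intro sum.cong) auto
    then show "root_comb v x = form_scale (of_nat (nat (v ! j))) (\<alpha> j) x"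
      using j nonneg by (simp add: form_scale_def)
  qed
  have "v ! j \<noteq> 1"
    using zero assms(3) len j by (metis nth_simple_vec length_simple_vec nth_equalityI)
  moreover have "v ! j \<noteq> 0"
  proof
    assume "v ! j = 0"
    then have "root_comb v = 0" unfolding comb by (simp add: fun_eq_iff form_scale_def)
    then show False using root by (simp add: roots_def)
  qed
  ultimately have "2 \<le> nat (v ! j)" using nonneg by linarith
  moreover obtain e f where "e \<in> weight_space H (\<alpha> j)" "f \<in> weight_space H (- \<alpha> j)"
      "\<alpha> j (bracket e f) = 2"
    using coroot_bracket[OF j] by metis
  ultimately have "weight_space H (root_comb v) = {0}"
    unfolding comb using no_multiple_root by blast
  then show False using root by (simp add: roots_def)
qed

text \<open>The reflection gives a root by \<open>reflect_weight\<close>. It alters only coordinate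
  \<open>j\<close>, so a positive coordinate elsewhere survives and prevents the new root from being
  negative.\<close>

lemma reflect_root_vec:
  assumes v: "v \<in> root_vecs" and j: "j < n" and "v \<noteq> simple_vec n j"
  shows "reflect C j v \<in> root_vecs"
proof -
  let ?w = "reflect C j v"
  have len: "length v = n" and root: "root_comb v \<in> roots H" using v by (auto simp: root_vecs_def)
  obtain i where i: "i < n" "i \<noteq> j" "0 < v ! i"
    using root_vec_other_coordinate[OF assms] by blast
  then have wi: "0 < ?w ! i" using len j by (simp add: reflect_nth)
  obtain e f where ef: "e \<in> weight_space H (\<alpha> j)" "f \<in> weight_space H (- \<alpha> j)" "bracket e f = h j"
      "\<alpha> j (bracket e f) = 2"
    using coroot_bracket[OF j] .
  have "weight_space H (root_comb ?w) \<noteq> {0}"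
    unfolding root_comb_reflect[OF j len] using root j ef(3)
    by (intro reflect_weight[OF ef(1,2,4)]) (auto simp: roots_def root_comb_coroot)
  moreover have "root_comb ?w \<noteq> 0"
  proof
    assume "root_comb ?w = 0"
    then have "?w = replicate n 0"
      using root_comb_inj[of ?w "replicate n 0"] len by (simp add: root_comb_replicate_0)
    then show False using wi i(1) by simp
  qed
  ultimately have wroot: "root_comb ?w \<in> roots H" using root_comb_dual by (simp add: roots_def)
  have "\<not> nonneg_comb \<Pi> (root_comb (map uminus ?w))"
    using wi i(1) len nth_mem[of i ?w] by (subst nonneg_comb_root_comb) (auto simp: not_le)
  then have "nonneg_comb \<Pi> (root_comb ?w)"
    using simple wroot len by (auto simp: simple_roots_def root_comb_minus)
  then show ?thesis using wroot len by (simp add: root_vecs_def nonneg_comb_root_comb)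
qed

lemma root_closed_root_vecs: "root_closed C root_vecs"
  unfolding root_closed_def
proof (intro conjI ballI allI impI)
  fix v assume v: "v \<in> root_vecs"
  then show "length v = n" by (simp add: root_vecs_def)
  show "0 \<le> x" if "x \<in> set v" for x using v that by (simp add: root_vecs_def)
  show "v \<noteq> replicate n 0"
    using v root_comb_replicate_0 by (auto simp: root_vecs_def roots_def)
next
  fix j assume j: "j < n"
  have "\<forall>x\<in>set (simple_vec n j). 0 \<le> x"
    by (auto simp: simple_vec_def dest: subsetD[OF set_update_subset_insert])
  then show "simple_vec n j \<in> root_vecs"
    using simple_root[OF j] by (simp add: root_vecs_def root_comb_simple_vec[OF j])
qed (simp add: reflect_root_vec)

text \<open>Both sets are closed in the same sense, so \<open>root_closed_subset\<close> applies in
  either direction.\<close>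

lemma root_vecs_eq:
  assumes "positive_inverse C D d" and "root_closed C P"
  shows "root_vecs = P"
  using root_closed_subset[OF assms(1)] assms(2) root_closed_root_vecs cartan_diagonal by blast

text \<open>\<open>root_comb\<close> is an order isomorphism from \<open>root_vecs\<close> onto the
  positive roots, so taking images matches antichains of equal size.\<close>

lemma num_antichains_eq:
  assumes fin: "finite root_vecs"
  shows "num_antichains H \<Pi> k = card (antichains_in vec_le root_vecs k)"
proof -
  have len: "length v = n" if "v \<in> root_vecs" for v using that by (simp add: root_vecs_def)
  have inj: "inj_on root_comb root_vecs" using root_comb_inj len by (intro inj_onI) auto
  have le: "root_le \<Pi> (root_comb v) (root_comb w) \<longleftrightarrow> vec_le v w"
      if "v \<in> root_vecs" "w \<in> root_vecs" for v w
    using root_le_root_comb len that by blast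
  have "{A \<in> antichains H \<Pi>. card A = k} = image root_comb ` antichains_in vec_le root_vecs k"
  proof (intro equalityI subsetI)
    fix A assume "A \<in> {A \<in> antichains H \<Pi>. card A = k}"
    then have A: "A \<subseteq> root_comb ` root_vecs" "\<forall>\<mu>\<in>A. \<forall>\<nu>\<in>A. root_le \<Pi> \<mu> \<nu> \<longrightarrow> \<mu> = \<nu>" "card A = k"
      by (auto simp: antichains_def positive_roots_eq)
    then obtain B where B: "B \<subseteq> root_vecs" "A = root_comb ` B" by (meson subset_imageE)
    have "card B = k" using A(3) B card_image[OF inj_on_subset[OF inj B(1)]] by simp
    moreover have "v = w" if "v \<in> B" "w \<in> B" "vec_le v w" for v w
    proof -
      have vw: "v \<in> root_vecs" "w \<in> root_vecs" using that B(1) by auto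
      then have "root_comb v = root_comb w" using that A(2) B(2) le[OF vw] by simp
      then show ?thesis using inj_onD[OF inj _ vw] by blast
    qed
    ultimately show "A \<in> image root_comb ` antichains_in vec_le root_vecs k"
      using B by (auto simp: antichains_in_def)
  next
    fix A assume "A \<in> image root_comb ` antichains_in vec_le root_vecs k"
    then obtain B where B: "B \<subseteq> root_vecs" "\<forall>v\<in>B. \<forall>w\<in>B. vec_le v w \<longrightarrow> v = w" "card B = k"
        "A = root_comb ` B"
      by (auto simp: antichains_in_def)
    have "card A = k" using B card_image[OF inj_on_subset[OF inj B(1)]] by simp
    moreover have "A \<in> antichains H \<Pi>"
    proof -
      have "\<mu> = \<nu>" if "\<mu> \<in> A" "\<nu> \<in> A" "root_le \<Pi> \<mu> \<nu>" for \<mu> \<nu>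
      proof -
        from \<open>\<mu> \<in> A\<close> \<open>\<nu> \<in> A\<close> B(4) obtain v w
          where vw: "v \<in> B" "w \<in> B" "\<mu> = root_comb v" "\<nu> = root_comb w"
          by blast
        then have "vec_le v w" using that(3) le[of v w] B(1) by auto
        then show ?thesis using vw B(2) by blast
      qed
      then show ?thesis
        using B(1,4) finite_subset[OF B(1) fin] by (auto simp: antichains_def positive_roots_eq)
    qed
    ultimately show "A \<in> {A \<in> antichains H \<Pi>. card A = k}" by simp
  qed
  moreover have "inj_on (image root_comb) (antichains_in vec_le root_vecs k)"
    by (rule inj_on_subset[OF inj_on_image_Pow[OF inj]]) (auto simp: antichains_in_def)
  ultimately show ?thesis by (simp add: num_antichains_def card_image)
qed

lemma dim_H:
  assumes D: "positive_inverse C D d"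
  shows "dim H = n"
proof -
  \<comment> \<open>This is d times the j-th fundamental coweight: up to the factor d, these vectors
    are dual to the simple roots, and they will be a basis of \<open>H\<close>.\<close>
  define \<omega> where "\<omega> j = (\<Sum>k<n. of_int (D ! k ! j) *s h k)" for j
  have d: "of_int d \<noteq> (0 :: 'k)" using D by (simp add: positive_inverse_def)
  have scale_H: "c *s x \<in> H" if "x \<in> H" for c x using subspace_scale[OF subspace_H that] .
  have \<omega>_H: "\<omega> j \<in> H" for j
    unfolding \<omega>_def by (intro subspace_sum[OF subspace_H] scale_H coroot_H) simp
  have \<alpha>_\<omega>: "\<alpha> i (\<omega> j) = (if i = j then of_int d else 0)" if "i < n" "j < n" for i j
  proof -
    have "\<alpha> i (\<omega> j) = (\<Sum>k<n. \<alpha> i (of_int (D ! k ! j) *s h k))"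
      unfolding \<omega>_def using that
      by (intro dual_sum_vectors[OF simple_root_dual subspace_H] scale_H coroot_H) auto
    also have "\<dots> = of_int (\<Sum>k<n. C ! i ! k * D ! k ! j)"
      using that by (simp add: dual_scale[OF simple_root_dual coroot_H] pairing mult.commute)
    also have "(\<Sum>k<n. C ! i ! k * D ! k ! j) = (if i = j then d else 0)"
      using D that
      by (simp add: positive_inverse_def interv_sum_list_conv_sum_set_nat atLeast0LessThan)
    finally show ?thesis by simp
  qed
  have comb: "\<alpha> i (\<Sum>j<n. c j *s \<omega> j) = c i * of_int d" if "i < n" for i c
  proof -
    have "\<alpha> i (\<Sum>j<n. c j *s \<omega> j) = (\<Sum>j<n. \<alpha> i (c j *s \<omega> j))"
      using that by (intro dual_sum_vectors[OF simple_root_dual subspace_H] scale_H \<omega>_H)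
    also have "\<dots> = (\<Sum>j<n. if i = j then c j * of_int d else 0)"
      using that by (intro sum.cong) (auto simp: dual_scale[OF simple_root_dual \<omega>_H] \<alpha>_\<omega>)
    finally show ?thesis using that by simp
  qed
  have inj: "inj_on \<omega> {..<n}"
    using \<alpha>_\<omega> d by (intro inj_onI) (metis lessThan_iff)
  show ?thesis
  proof (rule dim_unique)
    show "\<omega> ` {..<n} \<subseteq> H" using \<omega>_H by blast
    show "card (\<omega> ` {..<n}) = n" using card_image[OF inj] by simp
    show "independent (\<omega> ` {..<n})"
    proof -
      have "u z = 0" if "(\<Sum>z\<in>\<omega> ` {..<n}. u z *s z) = 0" "z \<in> \<omega> ` {..<n}" for u z
      proof -
        obtain i where i: "i < n" "z = \<omega> i" using \<open>z \<in> \<omega> ` {..<n}\<close> by blast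
        have "(\<Sum>j<n. u (\<omega> j) *s \<omega> j) = 0" using that(1) by (simp add: sum.reindex[OF inj])
        then have "u (\<omega> i) * of_int d = \<alpha> i 0" using comb[OF i(1), of "\<lambda>j. u (\<omega> j)"] by simp
        also have "\<dots> = 0"
          using dual_scale[OF simple_root_dual[OF i(1)] subspace_0[OF subspace_H], of 0] by simp
        finally show ?thesis using d i by simp
      qed
      then show ?thesis by (auto simp: dependent_finite)
    qed
    show "H \<subseteq> span (\<omega> ` {..<n})"
    proof
      fix x assume x: "x \<in> H"
      \<comment> \<open>The only possible expansion of \<open>x\<close>. The simple roots agree on
        \<open>x\<close> and \<open>s\<close>, hence so do all roots, and
        \<open>roots_separate\<close> gives x = s.\<close>
      define s where "s = (\<Sum>j<n. (\<alpha> j x / of_int d) *s \<omega> j)"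
      have s_H: "s \<in> H" unfolding s_def by (intro subspace_sum[OF subspace_H] scale_H \<omega>_H)
      have "\<alpha> i (x - s) = 0" if "i < n" for i
        using dual_diff[OF simple_root_dual[OF that] subspace_H x s_H] comb[OF that] d
        by (simp add: s_def)
      then have comb_0: "root_comb v (x - s) = 0" for v by (simp add: root_comb_apply)
      have "\<beta> (x - s) = 0" if "\<beta> \<in> roots H" for \<beta>
      proof -
        have "nonneg_comb \<Pi> \<beta> \<or> nonneg_comb \<Pi> (- \<beta>)" using simple that by (simp add: simple_roots_def)
        then obtain v where "\<beta> = root_comb v \<or> - \<beta> = root_comb v"
          unfolding nonneg_comb_iff by blast
        then show ?thesis using comb_0[of v] by (auto dest: fun_cong[of _ _ "x - s"])
      qed
      then have "x - s = 0" using roots_separate subspace_diff[OF subspace_H x s_H] by blast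
      then have "x = s" by simp
      also have "s \<in> span (\<omega> ` {..<n})"
        unfolding s_def by (intro span_sum span_scale span_base) blast
      finally show "x \<in> span (\<omega> ` {..<n})" .
    qed
  qed
qed

lemma narayana:
  assumes D: "positive_inverse C D d" and P: "root_closed C (set P)"
    and sorted: "sorted_wrt (\<lambda>x y. x \<noteq> y \<and> \<not> vec_le y x) P"
    and cs: "antichain_poly vec_le P = Poly cs" "length cs = Suc n" "rev cs = cs"
  shows "narayana_poly H \<Pi> = Poly cs" and "narayana_palindromic H \<Pi>"
proof -
  have num: "int (num_antichains H \<Pi> k) = nth_default 0 cs k" for k
    using coeff_antichain_poly[OF sorted, of k] cs(1)
    by (simp add: num_antichains_eq root_vecs_eq[OF D P])
  \<comment> \<open>With n + 1 coefficients the degree is at most n = \<open>dim H\<close>, so the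
    sum defining \<open>narayana_poly\<close> loses no term.\<close>
  have "degree (Poly cs) \<le> n"
    using cs(2) by (intro degree_le) (simp add: nth_default_beyond)
  then show "narayana_poly H \<Pi> = Poly cs"
    using poly_as_sum_of_monoms'[of "Poly cs" n]
    by (simp add: narayana_poly_def dim_H[OF D] num)
  show "narayana_palindromic H \<Pi>"
    unfolding narayana_palindromic_def dim_H[OF D]
  proof (intro allI impI)
    fix k assume "k \<le> n"
    then have "cs ! k = cs ! (n - k)"
      using cs(2,3) rev_nth[of k cs] by simp
    then have "int (num_antichains H \<Pi> k) = int (num_antichains H \<Pi> (n - k))"
      using \<open>k \<le> n\<close> cs(2) by (simp add: num nth_default_nth)
    then show "num_antichains H \<Pi> k = num_antichains H \<Pi> (n - k)" by simp
  qed
qed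

end

section \<open>The exceptional types\<close>

text \<open>Sorted by height, so that no root lies above a later one.\<close>

fun positive_root_list :: "exceptional_type \<Rightarrow> int list list" where
  "positive_root_list G2 =
    [[1,0], [0,1], [1,1], [2,1], [3,1], [3,2]]"
| "positive_root_list F4 =
    [[1,0,0,0], [0,1,0,0], [0,0,1,0], [0,0,0,1], [1,1,0,0], [0,1,1,0], [0,0,1,1], [1,1,1,0],
     [0,1,2,0], [0,1,1,1], [1,1,2,0], [1,1,1,1], [0,1,2,1], [1,2,2,0], [1,1,2,1], [0,1,2,2],
     [1,2,2,1], [1,1,2,2], [1,2,3,1], [1,2,2,2], [1,2,3,2], [1,2,4,2], [1,3,4,2], [2,3,4,2]]"
| "positive_root_list E6 =
    [[0,0,0,0,0,1], [0,0,0,0,1,0], [0,0,0,1,0,0], [0,0,1,0,0,0], [0,1,0,0,0,0], [1,0,0,0,0,0],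
     [0,0,0,0,1,1], [0,0,0,1,1,0], [0,0,1,1,0,0], [0,1,0,1,0,0], [1,0,1,0,0,0], [0,0,0,1,1,1],
     [0,0,1,1,1,0], [0,1,0,1,1,0], [0,1,1,1,0,0], [1,0,1,1,0,0], [0,0,1,1,1,1], [0,1,0,1,1,1],
     [0,1,1,1,1,0], [1,0,1,1,1,0], [1,1,1,1,0,0], [0,1,1,1,1,1], [0,1,1,2,1,0], [1,0,1,1,1,1],
     [1,1,1,1,1,0], [0,1,1,2,1,1], [1,1,1,1,1,1], [1,1,1,2,1,0], [0,1,1,2,2,1], [1,1,1,2,1,1],
     [1,1,2,2,1,0], [1,1,1,2,2,1], [1,1,2,2,1,1], [1,1,2,2,2,1], [1,1,2,3,2,1], [1,2,2,3,2,1]]"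
| "positive_root_list E7 =
    [[1,0,0,0,0,0,0], [0,1,0,0,0,0,0], [0,0,1,0,0,0,0], [0,0,0,1,0,0,0], [0,0,0,0,1,0,0],
     [0,0,0,0,0,1,0], [0,0,0,0,0,0,1], [1,0,1,0,0,0,0], [0,1,0,1,0,0,0], [0,0,1,1,0,0,0],
     [0,0,0,1,1,0,0], [0,0,0,0,1,1,0], [0,0,0,0,0,1,1], [1,0,1,1,0,0,0], [0,1,1,1,0,0,0],
     [0,1,0,1,1,0,0], [0,0,1,1,1,0,0], [0,0,0,1,1,1,0], [0,0,0,0,1,1,1], [1,1,1,1,0,0,0],
     [1,0,1,1,1,0,0], [0,1,1,1,1,0,0], [0,1,0,1,1,1,0], [0,0,1,1,1,1,0], [0,0,0,1,1,1,1],
     [1,1,1,1,1,0,0], [0,1,1,2,1,0,0], [1,0,1,1,1,1,0], [0,1,1,1,1,1,0], [0,1,0,1,1,1,1],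
     [0,0,1,1,1,1,1], [1,1,1,2,1,0,0], [1,1,1,1,1,1,0], [0,1,1,2,1,1,0], [1,0,1,1,1,1,1],
     [0,1,1,1,1,1,1], [1,1,2,2,1,0,0], [1,1,1,2,1,1,0], [0,1,1,2,2,1,0], [1,1,1,1,1,1,1],
     [0,1,1,2,1,1,1], [1,1,2,2,1,1,0], [1,1,1,2,2,1,0], [1,1,1,2,1,1,1], [0,1,1,2,2,1,1],
     [1,1,2,2,2,1,0], [1,1,2,2,1,1,1], [1,1,1,2,2,1,1], [0,1,1,2,2,2,1], [1,1,2,3,2,1,0],
     [1,1,2,2,2,1,1], [1,1,1,2,2,2,1], [1,2,2,3,2,1,0], [1,1,2,3,2,1,1], [1,1,2,2,2,2,1],
     [1,2,2,3,2,1,1], [1,1,2,3,2,2,1], [1,2,2,3,2,2,1], [1,1,2,3,3,2,1], [1,2,2,3,3,2,1],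
     [1,2,2,4,3,2,1], [1,2,3,4,3,2,1], [2,2,3,4,3,2,1]]"
| "positive_root_list E8 =
    [[1,0,0,0,0,0,0,0], [0,1,0,0,0,0,0,0], [0,0,1,0,0,0,0,0], [0,0,0,1,0,0,0,0],
     [0,0,0,0,1,0,0,0], [0,0,0,0,0,1,0,0], [0,0,0,0,0,0,1,0], [0,0,0,0,0,0,0,1],
     [1,0,1,0,0,0,0,0], [0,1,0,1,0,0,0,0], [0,0,1,1,0,0,0,0], [0,0,0,1,1,0,0,0],
     [0,0,0,0,1,1,0,0], [0,0,0,0,0,1,1,0], [0,0,0,0,0,0,1,1], [1,0,1,1,0,0,0,0],
     [0,1,1,1,0,0,0,0], [0,1,0,1,1,0,0,0], [0,0,1,1,1,0,0,0], [0,0,0,1,1,1,0,0],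
     [0,0,0,0,1,1,1,0], [0,0,0,0,0,1,1,1], [1,1,1,1,0,0,0,0], [1,0,1,1,1,0,0,0],
     [0,1,1,1,1,0,0,0], [0,1,0,1,1,1,0,0], [0,0,1,1,1,1,0,0], [0,0,0,1,1,1,1,0],
     [0,0,0,0,1,1,1,1], [1,1,1,1,1,0,0,0], [0,1,1,2,1,0,0,0], [1,0,1,1,1,1,0,0],
     [0,1,1,1,1,1,0,0], [0,1,0,1,1,1,1,0], [0,0,1,1,1,1,1,0], [0,0,0,1,1,1,1,1],
     [1,1,1,2,1,0,0,0], [1,1,1,1,1,1,0,0], [0,1,1,2,1,1,0,0], [1,0,1,1,1,1,1,0],
     [0,1,1,1,1,1,1,0], [0,1,0,1,1,1,1,1], [0,0,1,1,1,1,1,1], [1,1,2,2,1,0,0,0],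
     [1,1,1,2,1,1,0,0], [0,1,1,2,2,1,0,0], [1,1,1,1,1,1,1,0], [0,1,1,2,1,1,1,0],
     [1,0,1,1,1,1,1,1], [0,1,1,1,1,1,1,1], [1,1,2,2,1,1,0,0], [1,1,1,2,2,1,0,0],
     [1,1,1,2,1,1,1,0], [0,1,1,2,2,1,1,0], [1,1,1,1,1,1,1,1], [0,1,1,2,1,1,1,1],
     [1,1,2,2,2,1,0,0], [1,1,2,2,1,1,1,0], [1,1,1,2,2,1,1,0], [0,1,1,2,2,2,1,0],
     [1,1,1,2,1,1,1,1], [0,1,1,2,2,1,1,1], [1,1,2,3,2,1,0,0], [1,1,2,2,2,1,1,0],
     [1,1,1,2,2,2,1,0], [1,1,2,2,1,1,1,1], [1,1,1,2,2,1,1,1], [0,1,1,2,2,2,1,1],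
     [1,2,2,3,2,1,0,0], [1,1,2,3,2,1,1,0], [1,1,2,2,2,2,1,0], [1,1,2,2,2,1,1,1],
     [1,1,1,2,2,2,1,1], [0,1,1,2,2,2,2,1], [1,2,2,3,2,1,1,0], [1,1,2,3,2,2,1,0],
     [1,1,2,3,2,1,1,1], [1,1,2,2,2,2,1,1], [1,1,1,2,2,2,2,1], [1,2,2,3,2,2,1,0],
     [1,1,2,3,3,2,1,0], [1,2,2,3,2,1,1,1], [1,1,2,3,2,2,1,1], [1,1,2,2,2,2,2,1],
     [1,2,2,3,3,2,1,0], [1,2,2,3,2,2,1,1], [1,1,2,3,3,2,1,1], [1,1,2,3,2,2,2,1],
     [1,2,2,4,3,2,1,0], [1,2,2,3,3,2,1,1], [1,2,2,3,2,2,2,1], [1,1,2,3,3,2,2,1],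
     [1,2,3,4,3,2,1,0], [1,2,2,4,3,2,1,1], [1,2,2,3,3,2,2,1], [1,1,2,3,3,3,2,1],
     [2,2,3,4,3,2,1,0], [1,2,3,4,3,2,1,1], [1,2,2,4,3,2,2,1], [1,2,2,3,3,3,2,1],
     [2,2,3,4,3,2,1,1], [1,2,3,4,3,2,2,1], [1,2,2,4,3,3,2,1], [2,2,3,4,3,2,2,1],
     [1,2,3,4,3,3,2,1], [1,2,2,4,4,3,2,1], [2,2,3,4,3,3,2,1], [1,2,3,4,4,3,2,1],
     [2,2,3,4,4,3,2,1], [1,2,3,5,4,3,2,1], [2,2,3,5,4,3,2,1], [1,3,3,5,4,3,2,1],
     [2,3,3,5,4,3,2,1], [2,2,4,5,4,3,2,1], [2,3,4,5,4,3,2,1], [2,3,4,6,4,3,2,1],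
     [2,3,4,6,5,3,2,1], [2,3,4,6,5,4,2,1], [2,3,4,6,5,4,3,1], [2,3,4,6,5,4,3,2]]"

text \<open>The inverse Cartan matrix multiplied by its determinant, that is, the adjugate, given by
  rows.\<close>

fun cartan_inverse :: "exceptional_type \<Rightarrow> int list list" where
  "cartan_inverse G2 =
    [[2,1], [3,2]]"
| "cartan_inverse F4 =
    [[2,3,4,2], [3,6,8,4], [2,4,6,3], [1,2,3,2]]"
| "cartan_inverse E6 =
    [[4,3,5,6,4,2], [3,6,6,9,6,3], [5,6,10,12,8,4], [6,9,12,18,12,6], [4,6,8,12,10,5],
     [2,3,4,6,5,4]]"
| "cartan_inverse E7 =
    [[4,4,6,8,6,4,2], [4,7,8,12,9,6,3], [6,8,12,16,12,8,4], [8,12,16,24,18,12,6],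
     [6,9,12,18,15,10,5], [4,6,8,12,10,8,4], [2,3,4,6,5,4,3]]"
| "cartan_inverse E8 =
    [[4,5,7,10,8,6,4,2], [5,8,10,15,12,9,6,3], [7,10,14,20,16,12,8,4], [10,15,20,30,24,18,12,6],
     [8,12,16,24,20,15,10,5], [6,9,12,18,15,12,8,4], [4,6,8,12,10,8,6,3], [2,3,4,6,5,4,3,2]]"

fun cartan_determinant :: "exceptional_type \<Rightarrow> int" where
  "cartan_determinant G2 = 1"
| "cartan_determinant F4 = 1"
| "cartan_determinant E6 = 3"
| "cartan_determinant E7 = 2"
| "cartan_determinant E8 = 1"

fun narayana_coeffs :: "exceptional_type \<Rightarrow> int list" where
  "narayana_coeffs G2 = [1, 6, 1]"
| "narayana_coeffs F4 = [1, 24, 55, 24, 1]"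
| "narayana_coeffs E6 = [1, 36, 204, 351, 204, 36, 1]"
| "narayana_coeffs E7 = [1, 63, 546, 1470, 1470, 546, 63, 1]"
| "narayana_coeffs E8 = [1, 120, 1540, 6120, 9518, 6120, 1540, 120, 1]"

lemma positive_inverse_cartan_matrix:
  "positive_inverse (cartan_matrix t) (cartan_inverse t) (cartan_determinant t)"
  by (cases t; hypsubst; code_simp)

text \<open>By the uniqueness in \<open>root_vecs_eq\<close>, this finite check identifies the list
  with the set of all positive roots.\<close>

lemma root_closed_positive_root_list:
  "root_closed (cartan_matrix t) (set (positive_root_list t))"
  unfolding root_closed_set_iff by (cases t; hypsubst; code_simp)

lemma sorted_positive_root_list:
  "sorted_wrt (\<lambda>x y. x \<noteq> y \<and> \<not> vec_le y x) (positive_root_list t)"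
  by (cases t; hypsubst; code_simp)

lemma antichain_poly_positive_root_list:
  "antichain_poly vec_le (positive_root_list t) = Poly (narayana_coeffs t)"
proof -
  \<comment> \<open>Coefficient lists are concrete values that evaluation can compare; each ends in
    1, so it has no trailing zeros and is canonical.\<close>
  have "coeffs (antichain_poly vec_le (positive_root_list t)) = narayana_coeffs t"
    by (cases t; hypsubst; code_simp)
  then show ?thesis by (metis Poly_coeffs)
qed

theorem mainTheorem16:
  fixes scale :: "'k::{alg_closed_field, field_char_0} \<Rightarrow> 'g::ab_group_add \<Rightarrow> 'g"
    and bracket :: "'g \<Rightarrow> 'g \<Rightarrow> 'g"
    and H :: "'g set"
    and \<Pi> :: "('g \<Rightarrow> 'k) set"
    and t :: exceptional_type
  assumes "simple_lie_algebra scale bracket"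
    and "lie_algebra.cartan_subalgebra scale bracket H"
    and "lie_algebra.simple_roots scale bracket H \<Pi>"
    and "lie_algebra.has_cartan_matrix scale bracket H \<Pi> (cartan_matrix t)"
  shows "(t = G2 \<longrightarrow> lie_algebra.narayana_poly scale bracket H \<Pi> = [:1, 6, 1:]) \<and>
    (t = F4 \<longrightarrow> lie_algebra.narayana_poly scale bracket H \<Pi> = [:1, 24, 55, 24, 1:]) \<and>
    (t = E6 \<longrightarrow> lie_algebra.narayana_poly scale bracket H \<Pi> =
       [:1, 36, 204, 351, 204, 36, 1:]) \<and>
    (t = E7 \<longrightarrow> lie_algebra.narayana_poly scale bracket H \<Pi> =
       [:1, 63, 546, 1470, 1470, 546, 63, 1:]) \<and>
    (t = E8 \<longrightarrow> lie_algebra.narayana_poly scale bracket H \<Pi> =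
       [:1, 120, 1540, 6120, 9518, 6120, 1540, 120, 1:]) \<and>
    lie_algebra.narayana_palindromic scale bracket H \<Pi>"
proof -
  interpret simple_lie_algebra scale bracket by (rule assms(1))
  interpret cartan_decomposition scale bracket H
    by unfold_locales (rule assms(2))
  let ?C = "cartan_matrix t"
  obtain as where as: "distinct as" "set as = \<Pi>" "length as = length ?C"
      "\<forall>j<length ?C. \<exists>h. is_coroot H (as ! j) h \<and> (\<forall>i<length ?C. (as ! i) h = of_int (?C ! i ! j))"
    using assms(4) unfolding has_cartan_matrix_def by blast
  \<comment> \<open>One coroot is chosen for every index, turning the separate witnesses into the
    function that the locale needs.\<close>
  then obtain h where h: "\<forall>j<length ?C. is_coroot H (as ! j) (h j) \<and>
      (\<forall>i<length ?C. (as ! i) (h j) = of_int (?C ! i ! j))"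
    by metis
  interpret based_root_system scale bracket H \<Pi> ?C "(!) as" h
  proof
    show "bij_betw ((!) as) {..<length ?C} \<Pi>" using as by (intro bij_betw_nth) auto
  qed (use assms(3) h in auto)
  have len: "length (narayana_coeffs t) = Suc (length ?C)" and
    pal: "rev (narayana_coeffs t) = narayana_coeffs t"
    by (cases t; simp)+
  note narayana = narayana[OF positive_inverse_cartan_matrix root_closed_positive_root_list
      sorted_positive_root_list antichain_poly_positive_root_list len pal]
  show ?thesis using narayana by auto
qed

end
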